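(* Let $\vartheta_{\mathbf P}=(\vartheta,\mathbf P)$ be a compatible, irreducible Pisot random substitution on $\mathcal A=\{1,\dots,d\}$ with Rauzy measures $(\overline\mu_a)_{a\in\mathcal A}$, and let $v\in\mathcal A^+$. Then, for all $a\in\mathcal A$, $$\lim_{n\to\infty}\frac{1}{|\vartheta^n(v)|}\,\mu_a(\vartheta_{\mathbf P}^n(v))=\overline\mu_a$$ (in the sense of weak convergence) almost surely.
   Context: Let $\mathcal A^+$ be the set of non-empty finite words over $\mathcal A$, $|u|$ the length of $u$, $|u|_i$ the number of occurrences of $i$ in $u$, $\psi(u)=(|u|_1,\dots,|u|_d)^T$, and $u_{[1,m]}=u_1\cdots u_m$ (empty if $m=0$). A random substitution $\vartheta_{\mathbf P}=(\vartheta,\mathbf P)$ is a map $\vartheta$ assigning to each letter $i$ a non-empty finite set $\vartheta(i)\subset\mathcal A^+$ together with probability vectors $p_i\colon\vartheta(i)\to(0,1]$, $\sum_{v\in\vartheta(i)}p_i(v)=1$. For a word $u=u_1\cdots u_n$, $\vartheta_{\mathbf P}(u)$ is the random word obtained by independently replacing each letter $u_k$ by $v\in\vartheta(u_k)$ with probability $p_{u_k}(v)$ and concatenating in order; $(\vartheta_{\mathbf P}^n(u))_{n\ge0}$ is the Markov chain on $\mathcal A^+$ started at $u$ with these transition probabilities, defined on some probability space with probability $\mathbb P$ and expectation $\mathbb E$. It is compatible if $\psi(u)=\psi(v)$ for all $a\in\mathcal A$, $u,v\in\vartheta(a)$; then all realisations of $\vartheta_{\mathbf P}^n(v)$ have a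 common length $|\vartheta^n(v)|$, and the substitution matrix is $M_{i,j}=|v|_i$ for any $v\in\vartheta(j)$. It is primitive if $M$ is primitive with Perron–Frobenius eigenvalue $\lambda>1$. A compatible primitive random substitution is irreducible Pisot if $\lambda$ is a Pisot number and the characteristic polynomial of $M$ is irreducible over $\mathbb Z$. $\mathbf L,\mathbf R$ are left and right Perron–Frobenius eigenvectors of $M$ with $\|\mathbf R\|_1=1=\mathbf L^T\mathbf R$; $\mathbb H\subset\mathbb R^d$ is the hyperplane orthogonal to $\mathbf L$; $\pi$ is the linear projection along $\mathbf R$ onto $\mathbb H$. For a finite word $w$ and $a\in\mathcal A$, $\mu_a(w)=\sum_{0\le m\le|w|-1,\ w_{m+1}=a}\delta_{\pi(\psi(w_{[1,m]}))}$; for a random word this is a random measure. The Rauzy measure $\overline\mu_a$ is the weak limit $\overline\mu_a=\lim_{n\to\infty}|\vartheta^n(u)|^{-1}\,\mathbb E[\mu_a(\vartheta_{\mathbf P}^n(u))]$, which exists and is the same for every $u\in\mathcal A^+$. *)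

theory Defs
  imports
    "HOL-Analysis.Analysis"
    "HOL-Probability.Probability"
    "HOL-Computational_Algebra.Computational_Algebra"
begin

text \<open>
  The alphabet \<open>{1,\<dots>,d}\<close> is a finite type \<open>'d\<close> with \<open>d = CARD('d)\<close>; words are lists, and non-empty
  words are lists different from \<open>[]\<close>.
\<close>

definition abelianisation :: "'d::finite list \<Rightarrow> real ^ 'd" where
  "abelianisation u = (\<chi> i. real (count_list u i))"


section \<open>Random substitutions\<close>

text \<open>
  A random substitution is given by the laws \<open>P i\<close> of the images of the letters: \<open>set_pmf (P i)\<close> is
  the finite set \<open>\<vartheta>(i)\<close>, and \<open>pmf (P i)\<close> restricted to it is the probability vector \<open>p\<^sub>i\<close>.
\<close>

definition random_substitution :: "('d::finite \<Rightarrow> 'd list pmf) \<Rightarrow> bool" where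
  "random_substitution P \<longleftrightarrow> (\<forall>i. finite (set_pmf (P i)) \<and> [] \<notin> set_pmf (P i))"

text \<open>The law of \<open>\<vartheta>\<^sub>P(u)\<close>: letters are replaced independently and concatenated in order.\<close>

fun subst_word :: "('d::finite \<Rightarrow> 'd list pmf) \<Rightarrow> 'd list \<Rightarrow> 'd list pmf" where
  "subst_word P [] = return_pmf []"
| "subst_word P (i # u) =
     bind_pmf (P i) (\<lambda>v. bind_pmf (subst_word P u) (\<lambda>w. return_pmf (v @ w)))"

text \<open>The law of \<open>\<vartheta>\<^sub>P\<^sup>n(u)\<close>.\<close>

primrec subst_iter :: "('d::finite \<Rightarrow> 'd list pmf) \<Rightarrow> nat \<Rightarrow> 'd list \<Rightarrow> 'd list pmf" where
  "subst_iter P 0 u = return_pmf u"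
| "subst_iter P (Suc n) u = bind_pmf (subst_iter P n u) (subst_word P)"

text \<open>
  \<open>X\<close> is a realisation, on the probability space \<open>\<Omega>\<close>, of the Markov chain \<open>(\<vartheta>\<^sub>P\<^sup>n(u))\<^sub>n\<close>. The Markov
  property is expressed through the finite-dimensional distributions, which avoids conditioning on
  null events.
\<close>

definition subst_chain ::
    "('d::finite \<Rightarrow> 'd list pmf) \<Rightarrow> 'd list \<Rightarrow> 'w measure \<Rightarrow> (nat \<Rightarrow> 'w \<Rightarrow> 'd list) \<Rightarrow> bool" where
  "subst_chain P u \<Omega> X \<longleftrightarrow>
     prob_space \<Omega> \<and>
     (\<forall>n. X n \<in> measurable \<Omega> (count_space UNIV)) \<and>
     (AE \<omega> in \<Omega>. X 0 \<omega> = u) \<and>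
     (\<forall>n (ws :: nat \<Rightarrow> 'd list) w.
        measure \<Omega> {\<omega> \<in> space \<Omega>. (\<forall>k\<le>n. X k \<omega> = ws k) \<and> X (Suc n) \<omega> = w} =
        measure \<Omega> {\<omega> \<in> space \<Omega>. \<forall>k\<le>n. X k \<omega> = ws k} * pmf (subst_word P (ws n)) w)"

definition compatible :: "('d::finite \<Rightarrow> 'd list pmf) \<Rightarrow> bool" where
  "compatible P \<longleftrightarrow>
     (\<forall>a. \<forall>u \<in> set_pmf (P a). \<forall>v \<in> set_pmf (P a). abelianisation u = abelianisation v)"

text \<open>The common length \<open>|\<vartheta>\<^sup>n(u)|\<close> of the realisations; meaningful for compatible \<open>P\<close>.\<close>

definition iter_length :: "('d::finite \<Rightarrow> 'd list pmf) \<Rightarrow> nat \<Rightarrow> 'd list \<Rightarrow> nat" where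
  "iter_length P n u = (THE l. \<forall>w \<in> set_pmf (subst_iter P n u). length w = l)"


section \<open>The substitution matrix\<close>

text \<open>
  Column \<open>j\<close> is the abelianisation of an arbitrary element of \<open>\<vartheta>(j)\<close>. The matrix is
  polymorphic in the coefficient ring since it is used over the integers, reals and complex numbers.
\<close>

definition subst_matrix :: "('d::finite \<Rightarrow> 'd list pmf) \<Rightarrow> 'r::semiring_1 ^ 'd ^ 'd" where
  "subst_matrix P = (\<chi> i j. of_nat (count_list (SOME v. v \<in> set_pmf (P j)) i))"

text \<open>The multiplication of type class \<open>times\<close> on vectors is componentwise, hence \<open>**\<close>.\<close>

definition primitive_matrix :: "real ^ 'n ^ 'n \<Rightarrow> bool" where
  "primitive_matrix M \<longleftrightarrow> (\<exists>k>0. \<forall>i j. (((\<lambda>A. M ** A) ^^ k) (mat 1)) $ i $ j > 0)"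

text \<open>
  The Perron--Frobenius eigenvalue of a non-negative matrix is its spectral radius.
\<close>

definition pf_eigenvalue :: "complex ^ 'n ^ 'n \<Rightarrow> real" where
  "pf_eigenvalue M = Max {cmod z | z. \<exists>x. x \<noteq> 0 \<and> M *v x = z *s x}"

definition charpoly :: "'r::comm_ring_1 ^ 'n ^ 'n \<Rightarrow> 'r poly" where
  "charpoly M = det (\<chi> i j. (if i = j then [:0, 1:] else 0) - [:M $ i $ j:])"

text \<open>
  A Pisot number is a real algebraic integer greater than 1 whose other Galois conjugates have
  modulus less than 1. A monic integer polynomial that is irreducible over the integers and has the
  root \<open>x\<close> is the minimal polynomial of \<open>x\<close>.
\<close>

definition pisot_number :: "real \<Rightarrow> bool" where
  "pisot_number x \<longleftrightarrow> x > 1 \<and>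
     (\<exists>p :: int poly. lead_coeff p = 1 \<and> irreducible p \<and> poly (map_poly of_int p) x = 0 \<and>
        (\<forall>z :: complex. poly (map_poly of_int p) z = 0 \<and> z \<noteq> of_real x \<longrightarrow> cmod z < 1))"

abbreviation inflation_factor :: "('d::finite \<Rightarrow> 'd list pmf) \<Rightarrow> real" where
  "inflation_factor P \<equiv> pf_eigenvalue (subst_matrix P)"

definition primitive_substitution :: "('d::finite \<Rightarrow> 'd list pmf) \<Rightarrow> bool" where
  "primitive_substitution P \<longleftrightarrow> primitive_matrix (subst_matrix P) \<and> inflation_factor P > 1"

definition irreducible_pisot :: "('d::finite \<Rightarrow> 'd list pmf) \<Rightarrow> bool" where
  "irreducible_pisot P \<longleftrightarrow>
     compatible P \<and> primitive_substitution P \<and> pisot_number (inflation_factor P) \<and>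
     irreducible (charpoly (subst_matrix P) :: int poly)"

text \<open>\<open>L\<close> and \<open>R\<close> are the left and right Perron--Frobenius eigenvectors, normalised.\<close>

definition pf_eigenvectors :: "('d::finite \<Rightarrow> 'd list pmf) \<Rightarrow> real ^ 'd \<Rightarrow> real ^ 'd \<Rightarrow> bool" where
  "pf_eigenvectors P L R \<longleftrightarrow>
     (\<forall>i. L $ i > 0) \<and> (\<forall>i. R $ i > 0) \<and>
     L v* subst_matrix P = inflation_factor P *\<^sub>R L \<and>
     subst_matrix P *v R = inflation_factor P *\<^sub>R R \<and>
     (\<Sum>i\<in>UNIV. \<bar>R $ i\<bar>) = 1 \<and> L \<bullet> R = 1"


section \<open>Rauzy measures\<close>

text \<open>The projection along \<open>R\<close> onto the hyperplane orthogonal to \<open>L\<close>, for \<open>L \<bullet> R = 1\<close>.\<close>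

definition rauzy_proj :: "real ^ 'd::finite \<Rightarrow> real ^ 'd \<Rightarrow> real ^ 'd \<Rightarrow> real ^ 'd" where
  "rauzy_proj L R x = x - (L \<bullet> x) *\<^sub>R R"

lemma rauzy_proj_unique:
  fixes L R :: "real ^ 'd"
  assumes "L \<bullet> R = 1"
  shows "linear f \<and> f R = 0 \<and> (\<forall>x. L \<bullet> x = 0 \<longrightarrow> f x = x) \<longleftrightarrow> f = rauzy_proj L R"
proof
  assume f: "linear f \<and> f R = 0 \<and> (\<forall>x. L \<bullet> x = 0 \<longrightarrow> f x = x)"
  show "f = rauzy_proj L R"
  proof
    fix x
    have "L \<bullet> rauzy_proj L R x = 0"
      using assms by (simp add: rauzy_proj_def inner_diff_right)
    then have "rauzy_proj L R x = f (rauzy_proj L R x)"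
      using f by simp
    also have "\<dots> = f x"
      using f by (simp add: rauzy_proj_def linear_diff linear_scale)
    finally show "f x = rauzy_proj L R x" ..
  qed
next
  assume "f = rauzy_proj L R"
  then show "linear f \<and> f R = 0 \<and> (\<forall>x. L \<bullet> x = 0 \<longrightarrow> f x = x)"
    using assms by (auto simp: rauzy_proj_def inner_add_right algebra_simps intro!: linearI)
qed

text \<open>
  The measure \<open>\<mu>\<^sub>a(w)\<close>, as the image of the counting measure on the positions of \<open>a\<close> in \<open>w\<close>. List
  positions start at 0, so \<open>w ! m\<close> is \<open>w\<^bsub>m+1\<^esub>\<close> and \<open>take m w\<close> is \<open>w\<^bsub>[1,m]\<^esub>\<close>. Measures on the
  hyperplane are regarded as measures on the whole space.
\<close>

definition occurrence_measure ::
    "real ^ 'd \<Rightarrow> real ^ 'd \<Rightarrow> 'd::finite \<Rightarrow> 'd list \<Rightarrow> (real ^ 'd) measure" where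
  "occurrence_measure L R a w =
     distr (count_space {m. m < length w \<and> w ! m = a}) borel
       (\<lambda>m. rauzy_proj L R (abelianisation (take m w)))"

lemma emeasure_occurrence_measure:
  assumes "A \<in> sets borel"
  shows "emeasure (occurrence_measure L R a w) A =
    (\<Sum>m | m < length w \<and> w ! m = a.
       emeasure (return borel (rauzy_proj L R (abelianisation (take m w)))) A)"
proof -
  let ?S = "{m. m < length w \<and> w ! m = a}"
  let ?g = "\<lambda>m. rauzy_proj L R (abelianisation (take m w))"
  have "emeasure (occurrence_measure L R a w) A = emeasure (count_space ?S) (?g -` A \<inter> ?S)"
    using assms by (simp add: occurrence_measure_def emeasure_distr)
  also have "\<dots> = of_nat (card (?S \<inter> {m. ?g m \<in> A}))"
    by (simp add: emeasure_count_space_finite Int_commute vimage_def)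
  also have "\<dots> = (\<Sum>m\<in>?S. indicator A (?g m))"
    using assms by (simp add: indicator_def Int_def sum.If_cases)
  finally show ?thesis
    using assms by simp
qed

definition expected_occurrence_measure ::
    "('d::finite \<Rightarrow> 'd list pmf) \<Rightarrow> real ^ 'd \<Rightarrow> real ^ 'd \<Rightarrow> 'd \<Rightarrow> nat \<Rightarrow> 'd list
      \<Rightarrow> (real ^ 'd) measure" where
  "expected_occurrence_measure P L R a n u =
     measure_of UNIV (sets borel)
       (\<lambda>A. \<integral>\<^sup>+w. emeasure (occurrence_measure L R a w) A \<partial>measure_pmf (subst_iter P n u))"

lemma emeasure_expected_occurrence_measure:
  fixes P :: "'d::finite \<Rightarrow> 'd list pmf" and A :: "(real ^ 'd) set"
  assumes "A \<in> sets borel"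
  shows "emeasure (expected_occurrence_measure P L R a n u) A =
    (\<integral>\<^sup>+w. emeasure (occurrence_measure L R a w) A \<partial>measure_pmf (subst_iter P n u))"
proof (rule emeasure_measure_of[OF expected_occurrence_measure_def])
  let ?E = "\<lambda>A :: (real ^ 'd) set. \<integral>\<^sup>+w. emeasure (occurrence_measure L R a w) A \<partial>measure_pmf (subst_iter P n u)"
  have s: "sets (expected_occurrence_measure P L R a n u) = sets borel"
    using sets.sigma_sets_eq[of "borel :: (real ^ 'd) measure"]
    by (simp add: expected_occurrence_measure_def sets_measure_of_conv)
  show "countably_additive (sets (expected_occurrence_measure P L R a n u)) ?E"
    unfolding s
  proof (rule countably_additiveI)
    fix B :: "nat \<Rightarrow> (real ^ 'd) set"
    assume B: "range B \<subseteq> sets borel" "disjoint_family B"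
    have "(\<Sum>i. ?E (B i)) =
        (\<integral>\<^sup>+w. (\<Sum>i. emeasure (occurrence_measure L R a w) (B i)) \<partial>measure_pmf (subst_iter P n u))"
      by (rule nn_integral_suminf[symmetric]) simp
    also have "\<dots> = ?E (\<Union>i. B i)"
      using B by (intro nn_integral_cong suminf_emeasure) (auto simp: occurrence_measure_def)
    finally show "(\<Sum>i. ?E (B i)) = ?E (\<Union>i. B i)" .
  qed
  show "A \<in> sets (expected_occurrence_measure P L R a n u)"
    using assms s by simp
qed (auto simp: positive_def)

text \<open>The library has weak convergence only for measures on the real line.\<close>

definition weakly_converges :: "(nat \<Rightarrow> 'b::metric_space measure) \<Rightarrow> 'b measure \<Rightarrow> bool" where
  "weakly_converges \<mu> \<nu> \<longleftrightarrow>
     (\<forall>f :: 'b \<Rightarrow> real. continuous_on UNIV f \<and> bounded (range f) \<longrightarrow>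
        (\<lambda>n. \<integral>x. f x \<partial>\<mu> n) \<longlonglongrightarrow> (\<integral>x. f x \<partial>\<nu>))"

text \<open>The finite Borel measure that is the weak limit for every non-empty starting word.\<close>

definition rauzy_measure ::
    "('d::finite \<Rightarrow> 'd list pmf) \<Rightarrow> real ^ 'd \<Rightarrow> real ^ 'd \<Rightarrow> 'd \<Rightarrow> (real ^ 'd) measure" where
  "rauzy_measure P L R a =
     (THE \<nu>. finite_measure \<nu> \<and> sets \<nu> = sets borel \<and>
        (\<forall>u. u \<noteq> [] \<longrightarrow>
           weakly_converges
             (\<lambda>n. scale_measure (ennreal (1 / real (iter_length P n u)))
                    (expected_occurrence_measure P L R a n u)) \<nu>))"

end

theory Submission
  imports Defs
begin

text \<open>
  Write \<open>M\<close> for the substitution matrix, \<open>\<lambda>\<close> for the inflation factor, \<open>\<pi>\<close> for the projection along \<open>R\<close>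
  and \<open>I\<^sub>f(w)\<close> for the integral of a bounded continuous \<open>f\<close> with respect to \<open>\<mu>\<^sub>a(w)\<close>. The proof
  combines a contraction, which makes \<open>I\<^sub>f\<close> almost additive over blocks, with a law of large numbers
  for the blocks.

  Contraction. The characteristic polynomial of \<open>M\<close> and the minimal polynomial of \<open>\<lambda>\<close> are irreducible
  integer polynomials with a common root, so they have the same roots; by the Pisot property all
  eigenvalues of \<open>M\<close> on the hyperplane orthogonal to \<open>L\<close> lie in the open unit disc, and the powers
  of \<open>M\<close> tend to zero there exponentially (\<open>contraction\<close>). Hence the projections of the prefixes of
  all realisations stay in one bounded set (\<open>prefix_bound\<close>).

  Blocks. A realisation of \<open>\<vartheta>\<^sup>n\<^sup>+\<^sup>k(v)\<close> is a realisation \<open>w\<close> of \<open>\<vartheta>\<^sup>n(v)\<close> whose letters have been replaced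
  by independent realisations of \<open>\<vartheta>\<^sup>k\<close>. The block of the letter after the prefix \<open>p\<close> of \<open>w\<close> starts at
  \<open>M\<^sup>k \<pi>\<psi>(p)\<close>, which is small when \<open>k\<close> is large. By uniform continuity \<open>I\<^sub>f\<close> of the whole word is
  therefore close to the sum of \<open>I\<^sub>f\<close> over the blocks, relative to the length and uniformly in \<open>n\<close>
  (\<open>occ_sum_block_approx\<close>).

  Typical words. For fixed \<open>k\<close> there are finitely many possible blocks. By Chebyshev's inequality the
  empirical frequencies of all blocks are close to their expectations, except with a probability of
  order \<open>1/|\<vartheta>\<^sup>n(v)|\<close> (\<open>prob_not_typical_words\<close>). As these lengths grow like \<open>\<lambda>\<^sup>n\<close>, the Borel--Cantelli
  lemma makes almost every trajectory eventually typical for all \<open>k\<close> and all accuracies \<open>1/(q+1)\<close>. Along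
  such a trajectory \<open>I\<^sub>f/|\<vartheta>\<^sup>n(v)|\<close> converges for every \<open>f\<close> at once
  (\<open>occ_sum_tendsto_along_typical_words\<close>), because typicality is defined by frequencies of blocks and
  does not mention \<open>f\<close>.

  The limit. By the two estimates the limit must be that of \<open>\<lambda>\<^sup>-\<^sup>k \<Sum>\<^sub>b R\<^sub>b E I\<^sub>f(\<vartheta>\<^sup>k(b))\<close> as \<open>k\<close> grows. Read
  backwards in time this quantity is, up to the factor \<open>R\<^sub>a\<close>, the expectation of \<open>f\<close> at the
  partial sum of a random series \<open>\<Sum>\<^sub>i M\<^sup>i t\<^sub>i\<close> driven by a Markov chain on the letters
  (\<open>integral_address_point\<close>). The series converges by contraction, so its law, scaled by \<open>R\<^sub>a\<close>, is
  the limit. The expected measures have the same limit by the same block estimate, and this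
  property determines a finite measure; so it is the Rauzy measure (\<open>rauzy_measure_eq_limit_measure\<close>).
\<close>

(* Keeps the dollar sign for vector components, which is ambiguous otherwise. *)
no_notation fps_nth (infixl "$" 75)

section \<open>Conjugates of the inflation factor\<close>

abbreviation int_poly_eval :: "int poly \<Rightarrow> 'a::field_char_0 \<Rightarrow> 'a" where
  "int_poly_eval p x \<equiv> poly (map_poly of_int p) x"

lemma int_poly_eval_pCons:
  "int_poly_eval (pCons c p) x = of_int c + x * int_poly_eval p x"
  by (cases "pCons c p = 0") (auto simp: map_poly_pCons)

lemma int_poly_eval_add: "int_poly_eval (p + q) x = int_poly_eval p x + int_poly_eval q x"
  by (induction p q rule: poly_induct2) (simp_all add: int_poly_eval_pCons algebra_simps)

lemma int_poly_eval_smult: "int_poly_eval (smult c p) x = of_int c * int_poly_eval p x"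
  by (induction p) (simp_all add: int_poly_eval_pCons algebra_simps)

lemma int_poly_eval_mult: "int_poly_eval (p * q) x = int_poly_eval p x * int_poly_eval q x"
  by (induction p)
    (simp_all add: int_poly_eval_pCons int_poly_eval_add int_poly_eval_smult algebra_simps)

text \<open>
  The pseudo-remainder of \<open>p\<close> by \<open>g\<close> has the root \<open>x\<close> and smaller degree than \<open>g\<close>, so it vanishes and
  a constant multiple of \<open>p\<close> is a product \<open>g * q\<close>. As \<open>p\<close> is prime it divides a factor; it cannot
  divide \<open>q\<close>, since \<open>g\<close> would then be constant and have no root.
\<close>

lemma irreducible_dvd_minimal_degree:
  fixes p g :: "int poly" and x :: "'a::field_char_0"
  assumes "irreducible p" "int_poly_eval p x = 0"
    and g: "g \<noteq> 0" "int_poly_eval g x = 0"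
    and min: "\<And>h. h \<noteq> 0 \<Longrightarrow> int_poly_eval h x = 0 \<Longrightarrow> degree g \<le> degree h"
  shows "p dvd g"
proof -
  obtain q r where qr: "pseudo_divmod p g = (q, r)" by fastforce
  define c where "c = lead_coeff g ^ (Suc (degree p) - degree g)"
  have c: "c \<noteq> 0" using g by (simp add: c_def)
  have eq: "smult c p = g * q + r" and r: "r = 0 \<or> degree r < degree g"
    using pseudo_divmod[OF g(1) qr] by (auto simp: c_def)
  have "int_poly_eval (smult c p) x = int_poly_eval (g * q + r) x" by (simp only: eq)
  then have "int_poly_eval r x = 0"
    using assms by (simp add: int_poly_eval_add int_poly_eval_mult int_poly_eval_smult)
  then have "r = 0" using r min[of r] by fastforce
  then have eq: "smult c p = g * q" using eq by simp
  have pr: "prime_elem p" using assms(1) by (simp add: irreducible_imp_prime_elem)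
  have "p dvd g * q" unfolding eq[symmetric] by (rule dvd_smult) simp
  then consider "p dvd g" | "p dvd q" using prime_elem_dvd_multD[OF pr] by blast
  then show ?thesis
  proof cases
    case 2
    then obtain s where s: "q = p * s" by (elim dvdE)
    have "p * [:c:] = p * (g * s)" using eq s by (simp add: algebra_simps)
    then have gs: "[:c:] = g * s" using pr by (simp only: mult_cancel_left) auto
    then have "s \<noteq> 0" using c by auto
    have "degree [:c:] = degree g + degree s" unfolding gs using g(1) \<open>s \<noteq> 0\<close> by (rule degree_mult_eq)
    then have "degree g = 0" by simp
    then obtain b where "g = [:b:]" by (rule degree_eq_zeroE)
    then show ?thesis using g by (simp add: int_poly_eval_pCons)
  qed
qed

text \<open>
  Both polynomials divide a polynomial \<open>g\<close> of least degree with the root \<open>x\<close>. Since \<open>g\<close> has at most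
  the degree of \<open>p\<close>, it is a constant multiple of \<open>p\<close>, and every root of \<open>q\<close> is a root of \<open>g\<close>. This
  transfers the Pisot condition from the minimal polynomial of the inflation factor to the
  characteristic polynomial of the substitution matrix.
\<close>

lemma irreducible_common_root_imp_all_roots_common:
  fixes p q :: "int poly" and x z :: "'a::field_char_0"
  assumes p: "irreducible p" "int_poly_eval p x = 0"
    and q: "irreducible q" "int_poly_eval q x = 0"
    and z: "int_poly_eval q z = 0"
  shows "int_poly_eval p z = 0"
proof -
  let ?S = "\<lambda>h. h \<noteq> 0 \<and> int_poly_eval h x = 0"
  have "?S p" using p by auto
  then obtain g where g: "?S g" and min: "\<And>h. ?S h \<Longrightarrow> degree g \<le> degree h"
    using ex_has_least_nat[of ?S p degree] by blast
  have "p dvd g" "q dvd g" using irreducible_dvd_minimal_degree p q g min by metis+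
  then obtain s t where s: "g = p * s" and t: "g = q * t" by (elim dvdE)
  have ne: "p \<noteq> 0" "s \<noteq> 0" using g s by auto
  have "degree g = degree p + degree s" unfolding s using ne by (rule degree_mult_eq)
  moreover have "degree g \<le> degree p" using min \<open>?S p\<close> by blast
  ultimately have "degree s = 0" by simp
  then obtain b where b: "s = [:b:]" by (rule degree_eq_zeroE)
  have "int_poly_eval g z = 0" using z t by (simp add: int_poly_eval_mult)
  then show ?thesis using s b ne by (simp add: int_poly_eval_smult)
qed

lemma int_poly_eval_sum: "int_poly_eval (sum f A) x = (\<Sum>a\<in>A. int_poly_eval (f a) x)"
  by (induction A rule: infinite_finite_induct) (simp_all add: int_poly_eval_add)

lemma int_poly_eval_prod: "int_poly_eval (prod f A) x = (\<Prod>a\<in>A. int_poly_eval (f a) x)"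
  by (induction A rule: infinite_finite_induct) (simp_all add: int_poly_eval_mult map_poly_1')

lemma int_poly_eval_of_int: "int_poly_eval (of_int c) x = of_int c"
  by (simp add: of_int_poly int_poly_eval_pCons)

lemma int_poly_eval_charpoly:
  fixes A :: "int ^ 'n ^ 'n"
  shows "int_poly_eval (charpoly A) x = det (\<chi> i j. (if i = j then x else 0) - of_int (A $ i $ j))"
proof -
  have e: "int_poly_eval ((if i = j then [:0, 1:] else 0) - [:A $ i $ j:]) x =
      (if i = j then x else 0) - of_int (A $ i $ j)" for i j
    by (simp add: int_poly_eval_pCons)
  show ?thesis
    unfolding charpoly_def det_def
    by (simp add: int_poly_eval_sum int_poly_eval_mult int_poly_eval_prod int_poly_eval_of_int e)
qed

lemma eigenvalue_root_charpoly:
  fixes P :: "'d::finite \<Rightarrow> 'd list pmf" and x :: "'a::field_char_0 ^ 'd"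
  assumes "x \<noteq> 0" "subst_matrix P *v x = z *s x"
  shows "int_poly_eval (charpoly (subst_matrix P)) z = 0"
proof (rule ccontr)
  let ?B = "(\<chi> i j. (if i = j then z else 0) - of_int (subst_matrix P $ i $ j)) :: 'a ^ 'd ^ 'd"
  assume "\<not> ?thesis"
  then have "invertible ?B" by (simp add: int_poly_eval_charpoly invertible_det_nz)
  then obtain C where C: "C ** ?B = mat 1" by (auto simp: invertible_def)
  have "?B *v x = z *s x - subst_matrix P *v x"
    by (simp add: vec_eq_iff matrix_vector_mult_def subst_matrix_def left_diff_distrib sum_subtractf
        if_distrib[of "\<lambda>c. c * _"] cong: if_cong)
  then have "?B *v x = 0" using assms by simp
  then have "(C ** ?B) *v x = 0" by (simp flip: matrix_vector_mul_assoc)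
  then show False using C assms by simp
qed

section \<open>Exponential contraction on the hyperplane\<close>

text \<open>
  The vector \<open>q(A) y\<close>. Letting polynomials in \<open>A\<close> act on vectors avoids a ring structure on square
  matrices, whose type-class multiplication is componentwise.
\<close>

definition poly_act :: "complex poly \<Rightarrow> complex ^ 'n ^ 'n \<Rightarrow> complex ^ 'n \<Rightarrow> complex ^ 'n" where
  "poly_act q A y = (\<Sum>i\<le>degree q. coeff q i *s (((*v) A ^^ i) y))"

lemma poly_act_altdef:
  assumes "degree q \<le> N"
  shows "poly_act q A y = (\<Sum>i\<le>N. coeff q i *s (((*v) A ^^ i) y))"
  unfolding poly_act_def using assms
  by (intro sum.mono_neutral_left) (auto simp: coeff_eq_0)

lemma poly_act_0 [simp]: "poly_act 0 A y = 0"
  by (simp add: poly_act_def)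

lemma poly_act_add: "poly_act (p + q) A y = poly_act p A y + poly_act q A y"
proof -
  let ?N = "max (degree p) (degree q)"
  have "degree (p + q) \<le> ?N" by (rule degree_add_le_max)
  then show ?thesis
    by (simp add: poly_act_altdef[of _ ?N] vec.scale_left_distrib sum.distrib)
qed

lemma poly_act_sum: "poly_act (sum f S) A y = (\<Sum>i\<in>S. poly_act (f i) A y)"
  by (induction S rule: infinite_finite_induct) (simp_all add: poly_act_add)

lemma poly_act_monom: "poly_act (monom c i) A y = c *s (((*v) A ^^ i) y)"
proof -
  have "poly_act (monom c i) A y = (\<Sum>j\<le>i. (if j = i then c *s (((*v) A ^^ i) y) else 0))"
    by (subst poly_act_altdef[of _ i])
      (simp_all add: degree_monom_le if_distrib[of "\<lambda>c. c *s _"] cong: if_cong)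
  then show ?thesis by simp
qed

lemma matrix_vector_mult_sum_scaled:
  "A *v (\<Sum>i\<in>S. c i *s x i) = (\<Sum>i\<in>S. c i *s (A *v (x i :: 'a::field ^ 'n)))"
  by (induction S rule: infinite_finite_induct)
    (simp_all add: matrix_vector_right_distrib vector_scalar_commute)

lemma poly_act_pCons: "poly_act (pCons c q) A y = c *s y + A *v poly_act q A y"
proof -
  have "poly_act (pCons c q) A y =
      (\<Sum>i\<le>Suc (degree q). coeff (pCons c q) i *s (((*v) A ^^ i) y))"
    by (rule poly_act_altdef) (rule degree_pCons_le)
  then show ?thesis
    by (simp add: sum.atMost_Suc_shift poly_act_def matrix_vector_mult_sum_scaled del: sum.atMost_Suc)
qed

lemma poly_act_smult: "poly_act (smult c q) A y = c *s poly_act q A y"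
  by (induction q) (simp_all add: poly_act_pCons vec.scale_right_distrib vector_scalar_commute)

lemma poly_act_diff: "poly_act q A (x - y) = poly_act q A x - poly_act q A y"
  by (induction q) (simp_all add: poly_act_pCons vec.scale_right_diff_distrib matrix_vector_mult_diff_distrib)

lemma poly_act_scale: "poly_act q A (c *s x) = c *s poly_act q A x"
  by (induction q) (simp_all add: poly_act_pCons vec.scale_right_distrib vector_scalar_commute mult.commute)

lemma poly_act_commute: "poly_act q A (A *v x) = A *v poly_act q A x"
  by (induction q) (simp_all add: poly_act_pCons matrix_vector_right_distrib vector_scalar_commute)

lemma poly_act_linear_factor:
  "poly_act ([:-z, 1:] * q) A y = A *v poly_act q A y - z *s poly_act q A y"
  by (simp only: mult_pCons_left poly_act_add poly_act_smult poly_act_pCons) simp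

text \<open>
  As a real vector space \<open>\<complex>\<^sup>n\<close> has dimension \<open>2n\<close>, so the first \<open>2n + 1\<close> points of the orbit
  of \<open>y\<close> either repeat or are linearly dependent.
\<close>

lemma ex_annihilating_poly:
  fixes y :: "complex ^ 'n"
  shows "\<exists>q. q \<noteq> 0 \<and> poly_act q A y = 0"
proof (cases "inj_on (\<lambda>i. ((*v) A ^^ i) y) {..DIM(complex ^ 'n)}")
  case False
  then obtain i j where "((*v) A ^^ i) y = ((*v) A ^^ j) y" "i \<noteq> j" by (auto simp: inj_on_def)
  then have "poly_act (monom 1 i + monom (-1) j) A y = 0" "monom 1 i + monom (-1) j \<noteq> (0 :: complex poly)"
    by (auto simp: poly_act_add poly_act_monom poly_eq_iff)
  then show ?thesis by blast
next
  case True
  let ?f = "\<lambda>i. ((*v) A ^^ i) y" and ?I = "{..DIM(complex ^ 'n)}"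
  have "card (?f ` ?I) > DIM(complex ^ 'n)" using True by (simp add: card_image)
  then have "dependent (?f ` ?I)" using independent_bound[of "?f ` ?I"] by force
  then obtain u k where u: "(\<Sum>v\<in>?f ` ?I. u v *\<^sub>R v) = 0" and k: "k \<in> ?I" "u (?f k) \<noteq> 0"
    by (subst (asm) dependent_finite) auto
  define q where "q = (\<Sum>i\<in>?I. monom (complex_of_real (u (?f i))) i)"
  have "poly_act q A y = (\<Sum>i\<in>?I. complex_of_real (u (?f i)) *s ?f i)"
    by (simp add: q_def poly_act_sum poly_act_monom)
  also have "\<dots> = (\<Sum>i\<in>?I. u (?f i) *\<^sub>R ?f i)"
    by (intro sum.cong refl) (simp add: vec_eq_iff scaleR_conv_of_real[where 'a = complex])
  also have "\<dots> = 0" using u True by (simp add: sum.reindex)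
  finally have "poly_act q A y = 0" .
  moreover have "coeff q k = u (?f k)" using k by (simp add: q_def coeff_sum)
  then have "q \<noteq> 0" using k by auto
  ultimately show ?thesis by blast
qed

definition exp_decaying :: "(nat \<Rightarrow> 'a::real_normed_vector) \<Rightarrow> bool" where
  "exp_decaying s \<longleftrightarrow> (\<exists>C \<rho>. 0 \<le> \<rho> \<and> \<rho> < 1 \<and> (\<forall>n. norm (s n) \<le> C * \<rho> ^ n))"

lemma norm_scalar_mult: "norm (z *s (x :: complex ^ 'n)) = cmod z * norm x"
  by (simp add: norm_vec_def norm_mult L2_set_right_distrib)

text \<open>
  For any \<open>\<sigma>\<close> strictly between the two rates and 1, a bound \<open>K \<sigma>\<^sup>n\<close> is inherited by the next term
  as soon as \<open>C \<le> (\<sigma> - |z|) K\<close>.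
\<close>

lemma exp_decaying_recurrence:
  fixes s e :: "nat \<Rightarrow> complex ^ 'n"
  assumes e: "exp_decaying e" and z: "cmod z < 1" and rec: "\<And>n. s (Suc n) = z *s s n + e n"
  shows "exp_decaying s"
proof -
  obtain C \<rho> where \<rho>: "0 \<le> \<rho>" "\<rho> < 1" and C: "\<And>n. norm (e n) \<le> C * \<rho> ^ n"
    using e by (auto simp: exp_decaying_def)
  obtain \<sigma> where \<sigma>: "max (cmod z) \<rho> < \<sigma>" "\<sigma> < 1" using dense[of "max (cmod z) \<rho>" 1] z \<rho> by auto
  have "C \<ge> 0" using order_trans[OF norm_ge_zero C[of 0]] by simp
  define K where "K = max (norm (s 0)) (C / (\<sigma> - cmod z))"
  have "C / (\<sigma> - cmod z) \<le> K" by (simp add: K_def)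
  then have CK: "C \<le> (\<sigma> - cmod z) * K" using \<sigma> by (simp add: field_simps)
  have "norm (s n) \<le> K * \<sigma> ^ n" for n
  proof (induction n)
    case (Suc n)
    have "norm (s (Suc n)) \<le> cmod z * norm (s n) + norm (e n)"
      unfolding rec by (rule norm_triangle_le) (simp add: norm_scalar_mult)
    also have "\<dots> \<le> cmod z * (K * \<sigma> ^ n) + C * \<rho> ^ n"
      using Suc C by (intro add_mono mult_left_mono) auto
    also have "C * \<rho> ^ n \<le> ((\<sigma> - cmod z) * K) * \<sigma> ^ n"
      using CK \<open>C \<ge> 0\<close> \<rho> \<sigma> by (intro mult_mono power_mono) auto
    finally show ?case by (simp add: algebra_simps)
  qed (simp add: K_def)
  moreover have "0 \<le> \<sigma>" using \<sigma> \<rho> by auto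
  ultimately show ?thesis using \<sigma> unfolding exp_decaying_def by blast
qed

text \<open>
  This replaces the Jordan normal form. By induction on the degree of a polynomial annihilating \<open>y\<close>,
  split off a linear factor \<open>X - z\<close>. If \<open>|z| < 1\<close>, the orbit of \<open>A y - z y\<close> decays by induction
  and the orbit of \<open>y\<close> satisfies a contracting recurrence with this inhomogeneity. Otherwise \<open>z\<close>
  is no eigenvalue on \<open>W\<close>, so the factor acts injectively there and can be dropped.
\<close>

lemma exp_decaying_orbit:
  fixes A :: "complex ^ 'n ^ 'n"
  assumes add: "\<And>x y. x \<in> W \<Longrightarrow> y \<in> W \<Longrightarrow> x + y \<in> W"
    and scale: "\<And>c x. x \<in> W \<Longrightarrow> c *s x \<in> W"
    and inv: "\<And>x. x \<in> W \<Longrightarrow> A *v x \<in> W"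
    and eig: "\<And>x z. x \<in> W \<Longrightarrow> x \<noteq> 0 \<Longrightarrow> A *v x = z *s x \<Longrightarrow> cmod z < 1"
    and "y \<in> W"
  shows "exp_decaying (\<lambda>n. ((*v) A ^^ n) y)"
proof -
  have main: "exp_decaying (\<lambda>n. ((*v) A ^^ n) y)"
    if "q \<noteq> 0" "poly_act q A y = 0" "y \<in> W" "degree q = n" for q y n
    using that
  proof (induction n arbitrary: q y)
    case 0
    then obtain c where c: "q = [:c:]" by (auto elim: degree_eq_zeroE)
    then have "y = 0" using 0 by (auto simp: poly_act_pCons vec_eq_iff)
    have "((*v) A ^^ n) 0 = 0" for n by (induction n) simp_all
    then show ?case using \<open>y = 0\<close> unfolding exp_decaying_def
      by (auto intro!: exI[of _ 0])
  next
    case (Suc n)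
    have "\<not> constant (poly q)" using Suc.prems by (simp add: constant_degree)
    then obtain z where "poly q z = 0" using fundamental_theorem_of_algebra by blast
    then obtain q' where q': "q = [:-z, 1:] * q'" by (auto simp: poly_eq_0_iff_dvd elim: dvdE)
    have ne: "q' \<noteq> 0" using q' Suc.prems by auto
    have "degree q = degree [:-z, 1:] + degree q'"
      unfolding q' using ne by (intro degree_mult_eq) auto
    then have deg: "degree q' = n" using Suc.prems by simp
    let ?y' = "A *v y - z *s y" and ?u = "poly_act q' A y"
    have sub: "x - z *s x' \<in> W" if "x \<in> W" "x' \<in> W" for x x'
      using add[OF that(1) scale[OF that(2), of "-z"]] by simp
    have act: "A *v ?u - z *s ?u = 0" using Suc.prems q' poly_act_linear_factor by metis
    show ?case
    proof (cases "cmod z < 1")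
      case True
      have "poly_act q' A ?y' = 0"
        using act by (simp add: poly_act_diff poly_act_scale poly_act_commute)
      moreover have "?y' \<in> W" using Suc.prems inv sub by blast
      ultimately have "exp_decaying (\<lambda>n. ((*v) A ^^ n) ?y')" using Suc.IH ne deg by blast
      moreover have "((*v) A ^^ n) ?y' = ((*v) A ^^ Suc n) y - z *s ((*v) A ^^ n) y" for n
        by (induction n) (simp_all add: matrix_vector_mult_diff_distrib vector_scalar_commute)
      ultimately show ?thesis
        by - (rule exp_decaying_recurrence[where e = "\<lambda>n. ((*v) A ^^ n) ?y'", OF _ True], simp_all)
    next
      case False
      have "poly_act r A y \<in> W" for r
      proof (induction r)
        case 0
        then show ?case using scale[OF \<open>y \<in> W\<close>, of 0] by simp
      next
        case (pCons c r)
        then show ?case using Suc.prems by (auto simp: poly_act_pCons intro!: add scale inv)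
      qed
      then have "?u = 0" using eig[of ?u z] act False by auto
      then show ?thesis using Suc.IH ne deg Suc.prems by blast
    qed
  qed
  then show ?thesis using ex_annihilating_poly[of A y] \<open>y \<in> W\<close> by blast
qed

lemma linear_iterate:
  fixes A :: "real ^ 'n ^ 'n"
  shows "linear ((*v) A ^^ n)"
proof (induction n)
  case (Suc n)
  have "linear (\<lambda>x. A *v (((*v) A ^^ n) x))"
    using linear_compose[OF Suc matrix_vector_mul_linear[of A]] by (simp add: o_def)
  then show ?case by (simp add: o_def)
qed (simp add: linear_ident)

lemma matrix_power_mult_vector:
  fixes A :: "real ^ 'n ^ 'n"
  shows "((\<lambda>B. A ** B) ^^ k) (mat 1) *v x = ((*v) A ^^ k) x"
  by (induction k) (simp_all flip: matrix_vector_mul_assoc)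

lemma iterate_eigenvector:
  fixes A :: "real ^ 'n ^ 'n"
  assumes "A *v x = c *\<^sub>R x"
  shows "((*v) A ^^ k) x = c ^ k *\<^sub>R x"
  by (induction k) (simp_all add: assms matrix_vector_mult_scaleR)

definition complexify :: "real ^ 'n \<Rightarrow> complex ^ 'n" where
  "complexify x = (\<chi> i. complex_of_real (x $ i))"

lemma norm_complexify: "norm (complexify x) = norm x"
  by (simp add: complexify_def norm_vec_def)

lemma subst_matrix_complexify:
  "subst_matrix P *v complexify x = complexify (subst_matrix P *v x)"
  by (simp add: vec_eq_iff complexify_def matrix_vector_mult_def subst_matrix_def)

lemma int_poly_eval_of_real:
  "int_poly_eval p (complex_of_real x) = complex_of_real (int_poly_eval p x)"
  by (induction p) (simp_all add: int_poly_eval_pCons)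

locale pisot_substitution =
  fixes P :: "'d::finite \<Rightarrow> 'd list pmf" and L R :: "real ^ 'd"
  assumes random_substitution: "random_substitution P"
    and irreducible_pisot: "irreducible_pisot P"
    and pf_eigenvectors: "pf_eigenvectors P L R"
begin

abbreviation M :: "real ^ 'd ^ 'd" where "M \<equiv> subst_matrix P"

abbreviation Mpow :: "nat \<Rightarrow> real ^ 'd \<Rightarrow> real ^ 'd" where "Mpow n \<equiv> (*v) M ^^ n"

abbreviation lam :: real where "lam \<equiv> inflation_factor P"

lemma L_pos: "L $ i > 0" and R_pos: "R $ i > 0"
  and L_eigen: "L v* M = lam *\<^sub>R L" and R_eigen: "M *v R = lam *\<^sub>R R"
  and R_sum: "(\<Sum>i\<in>UNIV. R $ i) = 1" and L_R: "L \<bullet> R = 1"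
  using pf_eigenvectors by (auto simp: pf_eigenvectors_def abs_of_pos)

lemma lam_gt_1: "lam > 1"
  using irreducible_pisot by (simp add: irreducible_pisot_def primitive_substitution_def)

lemma R_nonzero: "R \<noteq> 0"
  using L_R by auto

lemma inner_L_M: "L \<bullet> (M *v x) = lam * (L \<bullet> x)"
proof -
  have "L \<bullet> (M *v x) = (L v* M) \<bullet> x" by (simp add: dot_lmul_matrix)
  then show ?thesis by (simp add: L_eigen)
qed

text \<open>
  Perron's argument: subtract from \<open>R\<close> the largest multiple of \<open>r\<close> that leaves a non-negative
  vector. The difference is an eigenvector with a zero entry, but a positive power of \<open>M\<close> makes
  every non-zero non-negative vector positive; so it is zero and \<open>R\<close> is proportional to \<open>r\<close>, which
  contradicts \<open>L \<bullet> R = 1\<close>.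
\<close>

lemma pf_eigenvalue_simple:
  assumes "M *v r = lam *\<^sub>R r" "L \<bullet> r = 0"
  shows "r = 0"
proof (rule ccontr)
  assume "r \<noteq> 0"
  have "\<exists>i. r $ i > 0"
  proof (rule ccontr)
    assume "\<not> ?thesis"
    then have "L $ i * r $ i \<le> 0" for i
      using L_pos by (simp add: mult_nonneg_nonpos less_imp_le not_less)
    then have "L $ i * r $ i = 0" for i
      using assms(2) sum_nonneg_eq_0_iff[of UNIV "\<lambda>i. - (L $ i * r $ i)"]
      by (auto simp: inner_vec_def sum_negf)
    then show False using \<open>r \<noteq> 0\<close> L_pos by (metis less_irrefl mult_eq_0_iff vec_eq_iff zero_index)
  qed
  then have pos: "{i. r $ i > 0} \<noteq> {}" by auto
  \<comment> \<open>the largest \<open>t\<close> with \<open>R - t r \<ge> 0\<close>\<close>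
  define t where "t = Min ((\<lambda>i. R $ i / r $ i) ` {i. r $ i > 0})"
  have "t \<in> (\<lambda>i. R $ i / r $ i) ` {i. r $ i > 0}" unfolding t_def using pos by (intro Min_in) auto
  then obtain i0 where i0: "r $ i0 > 0" "t = R $ i0 / r $ i0" by auto
  have "t > 0" using i0 R_pos by simp
  have t: "t \<le> R $ i / r $ i" if "r $ i > 0" for i unfolding t_def using that by (intro Min_le) auto
  define s where "s = R - t *\<^sub>R r"
  have s_nonneg: "s $ i \<ge> 0" for i
  proof (cases "r $ i > 0")
    case True
    then show ?thesis using t[of i] by (simp add: s_def field_simps)
  next
    case False
    then have "t * r $ i \<le> 0" using \<open>t > 0\<close> by (simp add: mult_nonneg_nonpos)
    then show ?thesis using R_pos[of i] by (simp add: s_def)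
  qed
  have s0: "s $ i0 = 0" using i0 by (simp add: s_def)
  have "M *v s = lam *\<^sub>R s"
    by (simp add: s_def matrix_vector_mult_diff_distrib matrix_vector_mult_scaleR R_eigen assms
        scaleR_diff_right)
  then have eig: "Mpow k s = lam ^ k *\<^sub>R s" for k by (rule iterate_eigenvector)
  obtain k where k: "\<And>i j. (((\<lambda>B. M ** B) ^^ k) (mat 1)) $ i $ j > 0"
    using irreducible_pisot
    by (auto simp: irreducible_pisot_def primitive_substitution_def primitive_matrix_def)
  have "(\<Sum>j\<in>UNIV. (((\<lambda>B. M ** B) ^^ k) (mat 1)) $ i0 $ j * s $ j) = 0"
    using matrix_power_mult_vector[of k M s] eig[of k] s0
    by (simp add: vec_eq_iff matrix_vector_mult_def)
  then have "(((\<lambda>B. M ** B) ^^ k) (mat 1)) $ i0 $ j * s $ j = 0" for j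
    using k s_nonneg by (subst (asm) sum_nonneg_eq_0_iff) (auto intro: mult_nonneg_nonneg less_imp_le)
  then have "s = 0" using k by (metis less_irrefl mult_eq_0_iff vec_eq_iff zero_index)
  then have "R = t *\<^sub>R r" by (simp add: s_def)
  then have "L \<bullet> R = t * (L \<bullet> r)" by simp
  then show False using L_R assms by simp
qed

text \<open>
  The eigenvalue \<open>z\<close> is a root of the irreducible characteristic polynomial, hence equal or conjugate
  to \<open>\<lambda>\<close>. Equality is excluded by the simplicity of \<open>\<lambda>\<close>, applied to the real and imaginary parts of
  the eigenvector.
\<close>

lemma eigenvalue_in_unit_disc:
  fixes x :: "complex ^ 'd"
  assumes x: "x \<noteq> 0" "subst_matrix P *v x = z *s x" and L: "(\<Sum>i\<in>UNIV. of_real (L $ i) * x $ i) = 0"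
  shows "cmod z < 1"
proof -
  let ?\<chi> = "charpoly (subst_matrix P) :: int poly"
  obtain p :: "int poly" where p: "irreducible p" "int_poly_eval p lam = 0"
    and conj: "\<And>z::complex. int_poly_eval p z = 0 \<Longrightarrow> z \<noteq> of_real lam \<Longrightarrow> cmod z < 1"
    using irreducible_pisot unfolding irreducible_pisot_def pisot_number_def by blast
  have "int_poly_eval ?\<chi> lam = 0"
    by (rule eigenvalue_root_charpoly[OF R_nonzero]) (simp add: R_eigen scalar_mult_eq_scaleR)
  then have "int_poly_eval ?\<chi> (complex_of_real lam) = 0" "int_poly_eval p (complex_of_real lam) = 0"
    using p by (simp_all add: int_poly_eval_of_real)
  moreover have "int_poly_eval ?\<chi> z = 0" using x by (rule eigenvalue_root_charpoly)
  moreover have "irreducible ?\<chi>" using irreducible_pisot by (simp add: irreducible_pisot_def)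
  ultimately have "int_poly_eval p z = 0"
    using irreducible_common_root_imp_all_roots_common p(1) by blast
  moreover have "z \<noteq> of_real lam"
  proof
    assume z: "z = of_real lam"
    have zero: "(\<chi> i. h (x $ i)) = 0" if h: "h = Re \<or> h = Im" for h
    proof (rule pf_eigenvalue_simple)
      show "M *v (\<chi> i. h (x $ i)) = lam *\<^sub>R (\<chi> i. h (x $ i))"
      proof (rule vec_eq_iff[THEN iffD2], rule allI)
        fix i
        have "(\<Sum>j\<in>UNIV. subst_matrix P $ i $ j * x $ j) = of_real lam * x $ i"
          using x(2) z by (simp add: vec_eq_iff matrix_vector_mult_def)
        then have "h (\<Sum>j\<in>UNIV. subst_matrix P $ i $ j * x $ j) = h (of_real lam * x $ i)" by simp
        then show "(M *v (\<chi> i. h (x $ i))) $ i = (lam *\<^sub>R (\<chi> i. h (x $ i))) $ i"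
          using h by (auto simp: matrix_vector_mult_def subst_matrix_def)
      qed
      show "L \<bullet> (\<chi> i. h (x $ i)) = 0"
        using h arg_cong[OF L, of h] by (auto simp: inner_vec_def)
    qed
    have "x = 0" using zero[of Re] zero[of Im] by (simp add: vec_eq_iff complex_eq_iff)
    then show False using x by simp
  qed
  ultimately show ?thesis using conj by blast
qed

lemma exp_decaying_Mpow:
  assumes "L \<bullet> x = 0"
  shows "exp_decaying (\<lambda>n. Mpow n x)"
proof -
  let ?A = "subst_matrix P :: complex ^ 'd ^ 'd"
  let ?W = "{x :: complex ^ 'd. (\<Sum>i\<in>UNIV. of_real (L $ i) * x $ i) = 0}"
  have "exp_decaying (\<lambda>n. ((*v) ?A ^^ n) (complexify x))"
  proof (rule exp_decaying_orbit[of ?W])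
    fix x :: "complex ^ 'd" and c
    assume x: "x \<in> ?W"
    have "(\<Sum>i\<in>UNIV. of_real (L $ i) * (c *s x) $ i) = c * (\<Sum>i\<in>UNIV. of_real (L $ i) * x $ i)"
      by (simp add: sum_distrib_left mult_ac)
    then show "c *s x \<in> ?W" using x by simp
    have col: "(\<Sum>i\<in>UNIV. of_real (L $ i) * ?A $ i $ j) = of_real (lam * L $ j)" for j
    proof -
      have "(\<Sum>i\<in>UNIV. L $ i * M $ i $ j) = lam * L $ j"
        using L_eigen by (simp add: vec_eq_iff vector_matrix_mult_def mult.commute)
      then have "of_real (\<Sum>i\<in>UNIV. L $ i * M $ i $ j) = complex_of_real (lam * L $ j)" by simp
      then show ?thesis by (simp add: subst_matrix_def)
    qed
    have "(\<Sum>i\<in>UNIV. of_real (L $ i) * (?A *v x) $ i) =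
        (\<Sum>i\<in>UNIV. \<Sum>j\<in>UNIV. of_real (L $ i) * ?A $ i $ j * x $ j)"
      by (simp add: matrix_vector_mult_def sum_distrib_left mult_ac)
    also have "\<dots> = (\<Sum>j\<in>UNIV. (\<Sum>i\<in>UNIV. of_real (L $ i) * ?A $ i $ j) * x $ j)"
      by (subst sum.swap) (simp add: sum_distrib_right)
    also have "\<dots> = of_real lam * (\<Sum>j\<in>UNIV. of_real (L $ j) * x $ j)"
      unfolding col by (simp add: sum_distrib_left mult_ac)
    finally show "?A *v x \<in> ?W" using x by simp
  next
    fix x z assume "x \<in> ?W" "x \<noteq> 0" "?A *v x = z *s x"
    then show "cmod z < 1" using eigenvalue_in_unit_disc by simp
  next
    have "(\<Sum>i\<in>UNIV. of_real (L $ i) * complexify x $ i) = complex_of_real (L \<bullet> x)"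
      by (simp add: complexify_def inner_vec_def)
    then show "complexify x \<in> ?W" using assms by simp
  qed (simp add: algebra_simps sum.distrib)
  moreover have "((*v) ?A ^^ n) (complexify x) = complexify (Mpow n x)" for n
    by (induction n) (simp_all add: subst_matrix_complexify)
  ultimately show ?thesis by (simp add: exp_decaying_def norm_complexify)
qed

abbreviation proj :: "real ^ 'd \<Rightarrow> real ^ 'd" where "proj \<equiv> rauzy_proj L R"

lemma linear_proj: "linear proj" and inner_L_proj: "L \<bullet> proj x = 0"
  using rauzy_proj_unique[OF L_R, of proj] L_R
  by (auto simp: rauzy_proj_def inner_diff_right)

lemma proj_M: "proj (M *v x) = M *v proj x"
  by (simp add: rauzy_proj_def inner_L_M matrix_vector_mult_diff_distrib matrix_vector_mult_scaleR R_eigen)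

lemma proj_Mpow: "proj (Mpow n x) = Mpow n (proj x)"
  by (induction n) (simp_all add: proj_M)

text \<open>
  The rates obtained for single orbits become uniform by expanding \<open>x\<close> in the projections of the
  standard basis.
\<close>

lemma contraction:
  obtains C \<rho> where "0 \<le> \<rho>" "\<rho> < 1" "0 \<le> C"
    "\<And>n x. L \<bullet> x = 0 \<Longrightarrow> norm (Mpow n x) \<le> C * norm x * \<rho> ^ n"
proof -
  have "\<forall>i. \<exists>C \<rho>. 0 \<le> \<rho> \<and> \<rho> < 1 \<and> (\<forall>n. norm (Mpow n (proj (axis i 1))) \<le> C * \<rho> ^ n)"
    using exp_decaying_Mpow inner_L_proj by (auto simp: exp_decaying_def)
  then obtain c r where cr: "\<And>i. 0 \<le> r i" "\<And>i. r i < 1"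
      "\<And>i n. norm (Mpow n (proj (axis i 1))) \<le> c i * r i ^ n"
    by metis
  have c0: "c i \<ge> 0" for i using order_trans[OF norm_ge_zero cr(3)[of 0 i]] by simp
  define \<rho> where "\<rho> = Max (range r)"
  have r\<rho>: "r i \<le> \<rho>" for i by (simp add: \<rho>_def)
  have "\<rho> \<in> range r" unfolding \<rho>_def by (rule Max_in) auto
  then have \<rho>: "0 \<le> \<rho>" "\<rho> < 1" using cr by auto
  have "norm (Mpow n x) \<le> (\<Sum>i\<in>UNIV. c i) * norm x * \<rho> ^ n" if "L \<bullet> x = 0" for n x
  proof -
    have lin: "linear (\<lambda>x. Mpow n (proj x))"
      using linear_compose[OF linear_proj linear_iterate] by (simp add: o_def)
    have "x = proj x" using that by (simp add: rauzy_proj_def)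
    then have "Mpow n x = Mpow n (proj (\<Sum>i\<in>UNIV. x $ i *\<^sub>R axis i 1))"
      using basis_expansion[of x] by (simp add: scalar_mult_eq_scaleR)
    also have "\<dots> = (\<Sum>i\<in>UNIV. x $ i *\<^sub>R Mpow n (proj (axis i 1)))"
      using linear_sum[OF lin, of "\<lambda>i. x $ i *\<^sub>R axis i 1" UNIV] by (simp add: linear_scale[OF lin])
    also have "norm \<dots> \<le> (\<Sum>i\<in>UNIV. c i * norm x * \<rho> ^ n)"
    proof (rule sum_norm_le)
      fix i
      have "norm (x $ i *\<^sub>R Mpow n (proj (axis i 1))) = \<bar>x $ i\<bar> * norm (Mpow n (proj (axis i 1)))" by simp
      also have "\<dots> \<le> norm x * (c i * \<rho> ^ n)"
        using component_le_norm_cart[of x i] order_trans[OF cr(3)[of n i] mult_left_mono[OF power_mono[OF r\<rho> cr(1)] c0]]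
        by (intro mult_mono) auto
      finally show "norm (x $ i *\<^sub>R Mpow n (proj (axis i 1))) \<le> c i * norm x * \<rho> ^ n" by (simp add: mult_ac)
    qed
    finally show ?thesis by (simp add: sum_distrib_right)
  qed
  moreover have "0 \<le> sum c UNIV" using c0 by (simp add: sum_nonneg)
  ultimately show ?thesis using \<rho> that by blast
qed

end

section \<open>Substituting words block by block\<close>

text \<open>
  The joint law of the independent images of the letters of a word. The random word
  \<open>subst_word Q u\<close> is their concatenation, from which the individual images cannot be recovered.
\<close>

primrec blocks :: "('d \<Rightarrow> 'd list pmf) \<Rightarrow> 'd list \<Rightarrow> 'd list list pmf" where
  "blocks Q [] = return_pmf []"
| "blocks Q (b # u) = bind_pmf (Q b) (\<lambda>v. map_pmf (Cons v) (blocks Q u))"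

lemma subst_word_eq_concat_blocks: "subst_word Q u = map_pmf concat (blocks Q u)"
  by (induction u) (simp_all add: map_bind_pmf pmf.map_comp o_def bind_return_pmf bind_map_pmf
      bind_assoc_pmf map_pmf_def[of "\<lambda>w. _ @ w"] flip: map_pmf_def)

lemma set_blocks: "vs \<in> set_pmf (blocks Q u) \<longleftrightarrow> list_all2 (\<lambda>b v. v \<in> set_pmf (Q b)) u vs"
  by (induction u arbitrary: vs) (auto simp: list_all2_Cons1)

lemma subst_word_append:
  "subst_word Q (u @ w) =
     bind_pmf (subst_word Q u) (\<lambda>x. bind_pmf (subst_word Q w) (\<lambda>y. return_pmf (x @ y)))"
  by (induction u) (simp_all add: bind_assoc_pmf bind_return_pmf bind_return_pmf')

lemma bind_subst_word:
  "bind_pmf (subst_word Q u) (subst_word P) = subst_word (\<lambda>b. bind_pmf (Q b) (subst_word P)) u"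
proof (induction u)
  case (Cons b u)
  have "bind_pmf (subst_word Q (b # u)) (subst_word P) =
      bind_pmf (Q b) (\<lambda>v. bind_pmf (subst_word Q u) (\<lambda>w. bind_pmf (subst_word P v)
        (\<lambda>x. bind_pmf (subst_word P w) (\<lambda>y. return_pmf (x @ y)))))"
    by (simp add: bind_assoc_pmf bind_return_pmf subst_word_append)
  also have "\<dots> = bind_pmf (Q b) (\<lambda>v. bind_pmf (subst_word P v) (\<lambda>x. bind_pmf (subst_word Q u)
        (\<lambda>w. bind_pmf (subst_word P w) (\<lambda>y. return_pmf (x @ y)))))"
    by (subst bind_commute_pmf) simp
  also have "\<dots> = subst_word (\<lambda>b. bind_pmf (Q b) (subst_word P)) (b # u)"
    by (simp add: bind_assoc_pmf flip: Cons.IH)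
  finally show ?case .
qed (simp add: bind_return_pmf)

lemma subst_word_return: "subst_word (\<lambda>b. return_pmf [b]) u = return_pmf u"
  by (induction u) (simp_all add: bind_return_pmf)

text \<open>
  The \<open>k\<close>-th iterate of a random substitution is itself a random substitution, with the laws
  of \<open>\<vartheta>\<^sup>k(b)\<close> as images. Facts about a single substitution step thus apply to \<open>k\<close> steps at once.
\<close>

lemma subst_iter_eq_subst_word: "subst_iter P k u = subst_word (\<lambda>b. subst_iter P k [b]) u"
proof (induction k)
  case (Suc k)
  show ?case by (simp add: bind_subst_word Suc)
qed (simp add: subst_word_return)

lemma subst_iter_add: "subst_iter P (n + k) u = bind_pmf (subst_iter P n u) (subst_iter P k)"
  by (induction k) (simp_all add: bind_return_pmf' bind_assoc_pmf)

lemma finite_set_subst_word: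
  "(\<And>b. finite (set_pmf (Q b))) \<Longrightarrow> finite (set_pmf (subst_word Q u))"
  by (induction u) auto

lemma finite_set_blocks:
  "(\<And>b. finite (set_pmf (Q b))) \<Longrightarrow> finite (set_pmf (blocks Q u))"
  by (induction u) auto

lemma finite_set_subst_iter:
  "(\<And>b. finite (set_pmf (P b))) \<Longrightarrow> finite (set_pmf (subst_iter P n u))"
  by (induction n) (auto intro: finite_set_subst_word)

lemma subst_word_Nil_iff:
  "(\<And>b. [] \<notin> set_pmf (Q b)) \<Longrightarrow> w \<in> set_pmf (subst_word Q u) \<Longrightarrow> w = [] \<longleftrightarrow> u = []"
  by (induction u arbitrary: w) auto

lemma subst_iter_Nil_iff:
  "(\<And>b. [] \<notin> set_pmf (P b)) \<Longrightarrow> w \<in> set_pmf (subst_iter P n u) \<Longrightarrow> w = [] \<longleftrightarrow> u = []"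
proof (induction n arbitrary: w)
  case (Suc n)
  then obtain x where "x \<in> set_pmf (subst_iter P n u)" "w \<in> set_pmf (subst_word P x)" by auto
  then show ?case using Suc.IH[of x] Suc.prems(1) subst_word_Nil_iff[of P w x] by blast
qed simp

text \<open>
  A prefix ends inside the image of some letter. When it is empty or exhausts the word, any image may
  serve as \<open>v\<close>, with \<open>m' = 0\<close>.
\<close>

lemma prefix_of_subst_word:
  assumes "w \<in> set_pmf (subst_word Q u)"
  shows "\<exists>j x b v m'. x \<in> set_pmf (subst_word Q (take j u)) \<and> v \<in> set_pmf (Q b) \<and>
    take m w = x @ take m' v"
  using assms
proof (induction u arbitrary: w m)
  case Nil
  \<comment> \<open>the image of an arbitrary letter, whose empty prefix is taken\<close>
  obtain v where "v \<in> set_pmf (Q undefined)" using set_pmf_not_empty[of "Q undefined"] by blast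
  then show ?case using Nil by (intro exI[of _ 0] exI[of _ "[]"] exI[of _ undefined] exI[of _ v]) auto
next
  case (Cons b u)
  then obtain v y where v: "v \<in> set_pmf (Q b)" and y: "y \<in> set_pmf (subst_word Q u)" "w = v @ y" by auto
  show ?case
  proof (cases "m \<le> length v")
    case True
    then show ?thesis using v y
      by (intro exI[of _ 0] exI[of _ "[]"] exI[of _ b] exI[of _ v] exI[of _ m]) auto
  next
    case False
    obtain j x c z m' where *: "x \<in> set_pmf (subst_word Q (take j u))" "z \<in> set_pmf (Q c)"
      "take (m - length v) y = x @ take m' z" using Cons.IH[OF y(1)] by blast
    then have "v @ x \<in> set_pmf (subst_word Q (take (Suc j) (b # u)))" using v by auto
    moreover have "take m w = (v @ x) @ take m' z" using * False y by simp
    ultimately show ?thesis using * by blast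
  qed
qed

section \<open>Empirical frequencies of blocks\<close>

lemma expectation_bind_finite:
  fixes h :: "'b \<Rightarrow> real"
  assumes "finite (set_pmf p)" "\<And>x. finite (set_pmf (f x))"
  shows "measure_pmf.expectation (bind_pmf p f) h =
    measure_pmf.expectation p (\<lambda>x. measure_pmf.expectation (f x) h)"
  using assms pmf_expectation_bind[of "set_pmf p" f p h]
  by (simp add: integral_measure_pmf[of "set_pmf p"])

lemma expectation_blocks_Cons:
  fixes h :: "'d list list \<Rightarrow> real"
  assumes fin: "\<And>b. finite (set_pmf (Q b))"
  shows "measure_pmf.expectation (blocks Q (b # u)) h =
    measure_pmf.expectation (Q b) (\<lambda>v. measure_pmf.expectation (blocks Q u) (\<lambda>vs. h (v # vs)))"
  by (simp add: expectation_bind_finite fin finite_set_blocks)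

lemma expectation_blocks_sum:
  fixes g :: "'d list \<Rightarrow> real"
  assumes fin: "\<And>b. finite (set_pmf (Q b))"
  shows "measure_pmf.expectation (blocks Q u) (\<lambda>vs. \<Sum>v\<leftarrow>vs. g v) =
    (\<Sum>b\<leftarrow>u. measure_pmf.expectation (Q b) g)"
proof (induction u)
  case (Cons b u)
  note int = integrable_measure_pmf_finite[OF fin]
    integrable_measure_pmf_finite[OF finite_set_blocks[of Q, OF fin]]
  show ?case
    unfolding expectation_blocks_Cons[OF fin] by (simp add: int Cons)
qed simp

text \<open>
  The images are independent, so the variances add up, and each of them is at most 1.
\<close>

lemma variance_blocks_sum:
  fixes g :: "'d list \<Rightarrow> real"
  assumes fin: "\<And>b. finite (set_pmf (Q b))" and g: "\<And>v. 0 \<le> g v \<and> g v \<le> 1"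
  shows "measure_pmf.expectation (blocks Q u)
      (\<lambda>vs. ((\<Sum>v\<leftarrow>vs. g v) - (\<Sum>b\<leftarrow>u. measure_pmf.expectation (Q b) g))\<^sup>2) \<le> real (length u)"
proof (induction u)
  case (Cons b u)
  note int = integrable_measure_pmf_finite[OF fin]
    integrable_measure_pmf_finite[OF finite_set_blocks[of Q, OF fin]]
  define e where "e = (\<lambda>b. measure_pmf.expectation (Q b) g)"
  define s where "s = (\<lambda>vs. (\<Sum>v\<leftarrow>vs. g v) - (\<Sum>b\<leftarrow>u. e b))"
  have e: "0 \<le> e b \<and> e b \<le> 1"
  proof -
    have "e b \<le> measure_pmf.expectation (Q b) (\<lambda>_. 1)"
      unfolding e_def using g int by (intro integral_mono) auto
    then show ?thesis using g unfolding e_def by (auto intro: integral_nonneg)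
  qed
  have s0: "measure_pmf.expectation (blocks Q u) s = 0"
    unfolding s_def e_def using expectation_blocks_sum[where Q = Q and u = u and g = g, OF fin]
    by (subst Bochner_Integration.integral_diff) (simp_all add: int)
  have sq: "((g v - e b) + s vs)\<^sup>2 = (g v - e b)\<^sup>2 + 2 * (g v - e b) * s vs + (s vs)\<^sup>2" for v vs
    by (simp add: power2_eq_square algebra_simps)
  have "measure_pmf.expectation (blocks Q (b # u))
      (\<lambda>vs. ((\<Sum>v\<leftarrow>vs. g v) - (\<Sum>b\<leftarrow>b # u. e b))\<^sup>2) =
      measure_pmf.expectation (Q b) (\<lambda>v. measure_pmf.expectation (blocks Q u)
        (\<lambda>vs. ((g v - e b) + s vs)\<^sup>2))"
    unfolding expectation_blocks_Cons[OF fin] by (simp add: s_def algebra_simps)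
  also have "\<dots> = measure_pmf.expectation (Q b) (\<lambda>v. (g v - e b)\<^sup>2) +
      measure_pmf.expectation (blocks Q u) (\<lambda>vs. (s vs)\<^sup>2)"
    unfolding sq by (simp add: int s0)
  also have "\<dots> \<le> 1 + real (length u)"
  proof (rule add_mono)
    have "(g v - e b)\<^sup>2 \<le> 1" for v
      using g[of v] e by (simp add: abs_square_le_1 abs_le_iff)
    then have "measure_pmf.expectation (Q b) (\<lambda>v. (g v - e b)\<^sup>2) \<le> measure_pmf.expectation (Q b) (\<lambda>_. 1)"
      using int by (intro integral_mono) auto
    then show "measure_pmf.expectation (Q b) (\<lambda>v. (g v - e b)\<^sup>2) \<le> 1" by simp
    show "measure_pmf.expectation (blocks Q u) (\<lambda>vs. (s vs)\<^sup>2) \<le> real (length u)"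
      using Cons by (simp add: s_def e_def)
  qed
  finally show ?case by (simp add: e_def)
qed simp

text \<open>
  Typicality controls the number of occurrences of every block instead of the sum of one
  function over the blocks, so that the exceptional events are common to all test functions.
\<close>

definition typical_blocks :: "('d \<Rightarrow> 'd list pmf) \<Rightarrow> 'd list \<Rightarrow> real \<Rightarrow> 'd list list set" where
  "typical_blocks Q u \<delta> = {vs \<in> set_pmf (blocks Q u).
     \<forall>x. \<bar>real (count_list vs x) - (\<Sum>b\<leftarrow>u. pmf (Q b) x)\<bar> \<le> \<delta> * length u}"

text \<open>
  Chebyshev's inequality for the number of occurrences of each of the finitely many possible
  blocks.
\<close>

lemma prob_not_typical_blocks:
  fixes Q :: "'d::finite \<Rightarrow> 'd list pmf" and \<delta> :: real
  assumes fin: "\<And>b. finite (set_pmf (Q b))" and "\<delta> > 0" "u \<noteq> []"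
  shows "measure_pmf.prob (blocks Q u) (- typical_blocks Q u \<delta>)
    \<le> card (\<Union>b. set_pmf (Q b)) / (\<delta>\<^sup>2 * length u)"
proof -
  let ?V = "\<Union>b. set_pmf (Q b)" and ?p = "measure_pmf (blocks Q u)"
  define d where "d = (\<lambda>x vs. real (count_list vs x) - (\<Sum>b\<leftarrow>u. pmf (Q b) x))"
  have len: "real (length u) > 0" using assms by simp
  have cl: "real (count_list vs x) = (\<Sum>v\<leftarrow>vs. indicator {x} v)" for vs and x :: "'d list"
    by (induction vs) auto
  have tail: "measure ?p {vs. \<delta> * length u < \<bar>d x vs\<bar>} \<le> 1 / (\<delta>\<^sup>2 * length u)" for x
  proof -
    have "measure ?p {vs. \<delta> * length u < \<bar>d x vs\<bar>} \<le> measure ?p {vs. (\<delta> * length u)\<^sup>2 \<le> (d x vs)\<^sup>2}"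
    proof (rule measure_pmf.finite_measure_mono, safe)
      fix vs assume "\<delta> * length u < \<bar>d x vs\<bar>"
      then show "(\<delta> * length u)\<^sup>2 \<le> (d x vs)\<^sup>2"
        using assms by (simp add: abs_le_square_iff[symmetric])
    qed simp
    also have "\<dots> \<le> measure_pmf.expectation (blocks Q u) (\<lambda>vs. (d x vs)\<^sup>2) / (\<delta> * length u)\<^sup>2"
      using integral_Markov_inequality_measure[of ?p "\<lambda>vs. (d x vs)\<^sup>2" "{}" "(\<delta> * length u)\<^sup>2"] assms
      by (simp add: integrable_measure_pmf_finite finite_set_blocks)
    also have "\<dots> \<le> real (length u) / (\<delta> * length u)\<^sup>2"
      using variance_blocks_sum[of Q "indicator {x}" u] fin
      by (intro divide_right_mono) (auto simp: d_def cl measure_pmf_single split: split_indicator)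
    also have "\<dots> = 1 / (\<delta>\<^sup>2 * length u)" using len by (simp add: power2_eq_square field_simps)
    finally show ?thesis .
  qed
  have "measure ?p (- typical_blocks Q u \<delta>) = measure ?p (- typical_blocks Q u \<delta> \<inter> set_pmf (blocks Q u))"
    by (simp add: measure_Int_set_pmf)
  also have "\<dots> \<le> measure ?p (\<Union>x\<in>?V. {vs. \<delta> * length u < \<bar>d x vs\<bar>})"
  proof (rule measure_pmf.finite_measure_mono, safe)
    fix vs assume vs: "vs \<in> set_pmf (blocks Q u)" "vs \<notin> typical_blocks Q u \<delta>"
    then obtain x where x: "\<delta> * length u < \<bar>d x vs\<bar>" by (auto simp: typical_blocks_def d_def not_le)
    have "x \<in> ?V"
    proof (rule ccontr)
      assume nx: "x \<notin> ?V"
      have "x \<notin> set vs" using vs(1) nx unfolding set_blocks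
        by (auto simp: list_all2_conv_all_nth in_set_conv_nth)
      moreover have "pmf (Q b) x = 0" for b using nx by (auto simp: set_pmf_iff)
      ultimately have "d x vs = 0" by (simp add: d_def count_list_0_iff)
      then show False using x assms by (simp add: mult_less_0_iff)
    qed
    then show "vs \<in> (\<Union>x\<in>?V. {vs. \<delta> * length u < \<bar>d x vs\<bar>})" using x by auto
  qed simp
  also have "\<dots> \<le> (\<Sum>x\<in>?V. measure ?p {vs. \<delta> * length u < \<bar>d x vs\<bar>})"
    using fin by (intro measure_pmf.finite_measure_subadditive_finite) auto
  also have "\<dots> \<le> (\<Sum>x\<in>?V. 1 / (\<delta>\<^sup>2 * length u))" by (intro sum_mono tail)
  finally show ?thesis by simp
qed

lemma typical_blocks_sum:
  fixes Q :: "'d::finite \<Rightarrow> 'd list pmf" and G \<delta> :: real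
  assumes fin: "\<And>b. finite (set_pmf (Q b))" and vs: "vs \<in> typical_blocks Q u \<delta>"
    and g: "\<And>x b. x \<in> set_pmf (Q b) \<Longrightarrow> \<bar>g x\<bar> \<le> G"
  shows "\<bar>(\<Sum>v\<leftarrow>vs. g v) - (\<Sum>b\<leftarrow>u. measure_pmf.expectation (Q b) g)\<bar>
    \<le> \<delta> * length u * (card (\<Union>b. set_pmf (Q b)) * G)"
proof -
  let ?V = "\<Union>b. set_pmf (Q b)"
  have finV: "finite ?V" using fin by simp
  have "set vs \<subseteq> ?V" using vs unfolding typical_blocks_def set_blocks
    by (fastforce simp: list_all2_conv_all_nth in_set_conv_nth)
  then have 1: "(\<Sum>v\<leftarrow>vs. g v) = (\<Sum>x\<in>?V. count_list vs x * g x)"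
  proof (induction vs)
    case (Cons v vs)
    have "(\<Sum>x\<in>?V. real (count_list (v # vs) x) * g x) =
        (\<Sum>x\<in>?V. (if x = v then g x else 0) + count_list vs x * g x)"
      by (intro sum.cong refl) (auto simp: algebra_simps)
    then show ?case using Cons finV by (simp add: sum.distrib)
  qed simp
  have 2: "(\<Sum>b\<leftarrow>u. measure_pmf.expectation (Q b) g) = (\<Sum>x\<in>?V. (\<Sum>b\<leftarrow>u. pmf (Q b) x) * g x)"
  proof (induction u)
    case (Cons b u)
    have "measure_pmf.expectation (Q b) g = (\<Sum>x\<in>?V. pmf (Q b) x * g x)"
      using finV by (subst integral_measure_pmf[of ?V]) auto
    then show ?case using Cons by (simp add: sum.distrib algebra_simps)
  qed simp
  have "\<bar>(\<Sum>v\<leftarrow>vs. g v) - (\<Sum>b\<leftarrow>u. measure_pmf.expectation (Q b) g)\<bar> =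
      \<bar>\<Sum>x\<in>?V. (real (count_list vs x) - (\<Sum>b\<leftarrow>u. pmf (Q b) x)) * g x\<bar>"
    unfolding 1 2 by (simp add: sum_subtractf left_diff_distrib)
  also have "\<dots> \<le> (\<Sum>x\<in>?V. \<delta> * real (length u) * G)"
  proof (rule order_trans[OF sum_abs sum_mono])
    fix x assume "x \<in> ?V"
    moreover have "\<bar>real (count_list vs x) - (\<Sum>b\<leftarrow>u. pmf (Q b) x)\<bar> \<le> \<delta> * length u"
      using vs by (simp add: typical_blocks_def)
    ultimately show "\<bar>(real (count_list vs x) - (\<Sum>b\<leftarrow>u. pmf (Q b) x)) * g x\<bar> \<le> \<delta> * length u * G"
      unfolding abs_mult using g by (intro mult_mono) (auto intro: order_trans[OF abs_ge_zero])
  qed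
  finally show ?thesis by (simp add: mult_ac)
qed

section \<open>Geometry of inflated words\<close>

lemma abelianisation_Nil [simp]: "abelianisation [] = 0"
  by (simp add: abelianisation_def vec_eq_iff)

lemma abelianisation_append [simp]:
  "abelianisation (u @ w) = abelianisation u + abelianisation w"
  by (simp add: abelianisation_def vec_eq_iff)

lemma sum_abelianisation: "(\<Sum>i\<in>UNIV. abelianisation w $ i) = real (length w)"
proof (induction w)
  case (Cons b w)
  have "abelianisation (b # w) $ i = (if i = b then 1 else 0) + abelianisation w $ i" for i
    by (simp add: abelianisation_def)
  then show ?case using Cons by (simp add: sum.distrib)
qed simp

lemma sum_list_letters:
  fixes h :: "'d::finite \<Rightarrow> real"
  shows "(\<Sum>b\<leftarrow>w. h b) = (\<Sum>b\<in>UNIV. abelianisation w $ b * h b)"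
proof (induction w)
  case (Cons c w)
  have "abelianisation (c # w) $ b * h b = (if b = c then h b else 0) + abelianisation w $ b * h b" for b
    by (simp add: abelianisation_def algebra_simps)
  then show ?case using Cons by (simp add: sum.distrib)
qed simp

context pisot_substitution
begin

lemma finite_images: "finite (set_pmf (P b))" and Nil_notin_images: "[] \<notin> set_pmf (P b)"
  using random_substitution by (auto simp: random_substitution_def)

lemma finite_images_iter: "finite (set_pmf (subst_iter P n u))"
  by (rule finite_set_subst_iter[OF finite_images])

text \<open>
  By compatibility, \<open>v\<close> has the abelianisation of the image that the definition of \<open>M\<close> selects.
\<close>

lemma abelianisation_image:
  assumes "v \<in> set_pmf (P b)"
  shows "abelianisation v $ i = M $ i $ b"
proof -
  have "(SOME v. v \<in> set_pmf (P b)) \<in> set_pmf (P b)" using assms by (rule someI)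
  then have "abelianisation v = abelianisation (SOME v. v \<in> set_pmf (P b))"
    using assms irreducible_pisot unfolding irreducible_pisot_def compatible_def by blast
  then show ?thesis by (simp add: subst_matrix_def) (simp add: abelianisation_def)
qed

lemma abelianisation_subst_word:
  "w \<in> set_pmf (subst_word P u) \<Longrightarrow> abelianisation w = M *v abelianisation u"
proof (induction u arbitrary: w)
  case (Cons b u)
  then obtain v y where v: "v \<in> set_pmf (P b)" "y \<in> set_pmf (subst_word P u)" "w = v @ y" by auto
  have "abelianisation (b # u) = axis b 1 + abelianisation u"
    by (simp add: abelianisation_def vec_eq_iff axis_def)
  moreover have "M *v axis b 1 = abelianisation v"
    using abelianisation_image[OF v(1)] by (simp add: vec_eq_iff matrix_vector_mul_component inner_axis matrix_vector_mult_basis column_def)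
  ultimately show ?case using Cons.IH[OF v(2)] v by (simp add: matrix_vector_right_distrib)
qed simp

lemma abelianisation_subst_iter:
  "w \<in> set_pmf (subst_iter P n u) \<Longrightarrow> abelianisation w = Mpow n (abelianisation u)"
  by (induction n arbitrary: w) (auto dest!: abelianisation_subst_word)

lemma length_subst_iter:
  assumes "w \<in> set_pmf (subst_iter P n u)"
  shows "real (length w) = (\<Sum>i\<in>UNIV. Mpow n (abelianisation u) $ i)"
  using abelianisation_subst_iter[OF assms] sum_abelianisation[of w] by simp

lemma iter_length_eq:
  assumes "w \<in> set_pmf (subst_iter P n u)"
  shows "iter_length P n u = length w"
  unfolding iter_length_def
proof (rule the_equality)
  show "\<forall>w'\<in>set_pmf (subst_iter P n u). length w' = length w"
    using length_subst_iter assms by (metis of_nat_eq_iff)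
qed (use assms in auto)

lemma real_iter_length: "real (iter_length P n u) = (\<Sum>i\<in>UNIV. Mpow n (abelianisation u) $ i)"
proof -
  obtain w where w: "w \<in> set_pmf (subst_iter P n u)" using set_pmf_not_empty[of "subst_iter P n u"] by blast
  show ?thesis using iter_length_eq[OF w] length_subst_iter[OF w] by simp
qed

lemma iter_length_pos: "u \<noteq> [] \<Longrightarrow> iter_length P n u > 0"
proof -
  assume "u \<noteq> []"
  obtain w where w: "w \<in> set_pmf (subst_iter P n u)" using set_pmf_not_empty[of "subst_iter P n u"] by blast
  then have "w \<noteq> []" using subst_iter_Nil_iff[OF Nil_notin_images w] \<open>u \<noteq> []\<close> by simp
  then show ?thesis using iter_length_eq[OF w] by simp
qed

text \<open>
  The displacement along \<open>w\<close>: the point of the hyperplane at which a word placed after \<open>w\<close> starts.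
\<close>

definition disp :: "'d list \<Rightarrow> real ^ 'd" where
  "disp w = proj (abelianisation w)"

lemma disp_Nil [simp]: "disp [] = 0" and disp_append [simp]: "disp (u @ w) = disp u + disp w"
  by (simp_all add: disp_def linear_0[OF linear_proj] linear_add[OF linear_proj])

lemma inner_L_disp [simp]: "L \<bullet> disp w = 0"
  by (simp add: disp_def inner_L_proj)

lemma disp_subst_word: "w \<in> set_pmf (subst_word P u) \<Longrightarrow> disp w = M *v disp u"
  by (simp add: disp_def abelianisation_subst_word proj_M)

lemma disp_subst_iter: "w \<in> set_pmf (subst_iter P n u) \<Longrightarrow> disp w = Mpow n (disp u)"
  by (simp add: disp_def abelianisation_subst_iter proj_Mpow)

lemma norm_disp_le: "\<exists>K\<ge>(0::real). \<forall>w. norm (disp w) \<le> K * real (length w)"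
proof -
  define K where "K = (\<Sum>b\<in>UNIV. norm (disp [b]))"
  have K: "norm (disp [b]) \<le> K" for b unfolding K_def by (rule member_le_sum) auto
  have "norm (disp w) \<le> K * real (length w)" for w
  proof (induction w)
    case (Cons b w)
    have "norm (disp (b # w)) \<le> norm (disp [b]) + norm (disp w)"
      using disp_append[of "[b]" w] norm_triangle_ineq[of "disp [b]" "disp w"] by simp
    then show ?case using Cons K[of b] by (simp add: algebra_simps)
  qed simp
  moreover have "K \<ge> 0" unfolding K_def by (rule sum_nonneg) simp
  ultimately show ?thesis by blast
qed

lemma image_prefix_bound: "\<exists>B\<ge>0. \<forall>b v m. v \<in> set_pmf (P b) \<longrightarrow> norm (disp (take m v)) \<le> B"
proof -
  obtain K where K: "K \<ge> 0" "\<And>w. norm (disp w) \<le> K * real (length w)" using norm_disp_le by blast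
  define N where "N = Max (length ` (\<Union>b. set_pmf (P b)))"
  have "norm (disp (take m v)) \<le> K * real N" if "v \<in> set_pmf (P b)" for b v m
  proof -
    have "length v \<le> N" unfolding N_def using that finite_images by (intro Max_ge) auto
    then have "K * length (take m v) \<le> K * real N" using K by (intro mult_left_mono) auto
    then show ?thesis using K(2)[of "take m v"] by linarith
  qed
  then show ?thesis using K(1) by (intro exI[of _ "K * real N"]) auto
qed

text \<open>
  A prefix of a realisation is the image of a prefix one level below, followed by a prefix of the
  image of a letter. Its displacement is therefore \<open>M x + t\<close> with \<open>x\<close> of the same kind and \<open>t\<close>
  in a finite set. A bound on the norm of \<open>x\<close> alone is not preserved by this map because \<open>M\<close> need not
  contract in one step; the family of bounds \<open>\<parallel>M\<^sup>i x\<parallel> \<le> B \<rho>\<^sup>i\<close> for all \<open>i\<close> is preserved as soon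
  as \<open>B \<rho> + C T \<le> B\<close>.
\<close>

lemma prefix_bound:
  "\<exists>B \<rho>. 0 \<le> \<rho> \<and> \<rho> < 1 \<and> 0 \<le> B \<and> (\<forall>u n w m i. length u \<le> l \<longrightarrow> w \<in> set_pmf (subst_iter P n u) \<longrightarrow>
     norm (Mpow i (disp (take m w))) \<le> B * \<rho> ^ i)"
proof -
  obtain \<rho> C where \<rho>: "0 \<le> \<rho>" "\<rho> < 1" "0 \<le> C"
    and C: "\<And>n x. L \<bullet> x = 0 \<Longrightarrow> norm (Mpow n x) \<le> C * norm x * \<rho> ^ n"
    using contraction by metis
  obtain K where K: "K \<ge> 0" "\<And>w. norm (disp w) \<le> K * real (length w)" using norm_disp_le by blast
  obtain T where T: "T \<ge> 0" "\<And>b v m. v \<in> set_pmf (P b) \<Longrightarrow> norm (disp (take m v)) \<le> T"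
    using image_prefix_bound by blast
  \<comment> \<open>the first summand covers the starting word, the second one yields \<open>B \<rho> + C T \<le> B\<close>\<close>
  define B where "B = C * (K * l) + C * T / (1 - \<rho>)"
  have B: "B * \<rho> + C * T \<le> B" and B0: "C * (K * l) \<le> B"
  proof -
    have "C * T = (C * T / (1 - \<rho>)) * (1 - \<rho>)" using \<rho> by simp
    also have "\<dots> \<le> B * (1 - \<rho>)" unfolding B_def using \<rho> K T by (intro mult_right_mono) auto
    finally show "B * \<rho> + C * T \<le> B" by (simp add: algebra_simps)
    show "C * (K * l) \<le> B" unfolding B_def using \<rho> T by simp
  qed
  have "norm (Mpow i (disp (take m w))) \<le> B * \<rho> ^ i"
    if "length u \<le> l" "w \<in> set_pmf (subst_iter P n u)" for u n w m i
    using that(2)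
  proof (induction n arbitrary: w m i)
    case 0
    then have "K * length (take m w) \<le> K * l" using that K by (intro mult_left_mono) auto
    then have "norm (disp (take m w)) \<le> K * l" using K(2)[of "take m w"] by linarith
    then have "C * norm (disp (take m w)) * \<rho> ^ i \<le> C * (K * l) * \<rho> ^ i"
      using \<rho> by (intro mult_right_mono mult_left_mono) auto
    also have "\<dots> \<le> B * \<rho> ^ i" using B0 \<rho> by (intro mult_right_mono) auto
    finally show ?case using C[OF inner_L_disp] order_trans by blast
  next
    case (Suc n)
    then obtain w' where w': "w' \<in> set_pmf (subst_iter P n u)" "w \<in> set_pmf (subst_word P w')" by auto
    obtain j x b v m' where x: "x \<in> set_pmf (subst_word P (take j w'))" and v: "v \<in> set_pmf (P b)"
      and eq: "take m w = x @ take m' v"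
      using prefix_of_subst_word[OF w'(2)] by blast
    have "Mpow i (disp (take m w)) = Mpow (Suc i) (disp (take j w')) + Mpow i (disp (take m' v))"
      using eq disp_subst_word[OF x] by (simp add: linear_add[OF linear_iterate] funpow_swap1)
    also have "norm \<dots> \<le> B * \<rho> ^ Suc i + C * T * \<rho> ^ i"
    proof (rule order_trans[OF norm_triangle_ineq add_mono])
      show "norm (Mpow (Suc i) (disp (take j w'))) \<le> B * \<rho> ^ Suc i" by (rule Suc.IH[OF w'(1)])
      have "C * norm (disp (take m' v)) * \<rho> ^ i \<le> C * T * \<rho> ^ i"
        using \<rho> T(2)[OF v] by (intro mult_right_mono mult_left_mono) auto
      then show "norm (Mpow i (disp (take m' v))) \<le> C * T * \<rho> ^ i"
        using C[OF inner_L_disp] order_trans by blast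
    qed
    also have "\<dots> = (B * \<rho> + C * T) * \<rho> ^ i" by (simp add: algebra_simps)
    also have "\<dots> \<le> B * \<rho> ^ i" using B \<rho> by (intro mult_right_mono) auto
    finally show ?case .
  qed
  moreover have "0 \<le> B" unfolding B_def using \<rho> K T by auto
  ultimately show ?thesis using \<rho> by blast
qed

section \<open>Sums over the occurrences of a letter\<close>

text \<open>
  The integral of \<open>f\<close> with respect to \<open>\<mu>\<^sub>a(w)\<close>. Removing the first letter translates the remaining
  points, which the recursion absorbs into \<open>f\<close>.
\<close>

fun occ_sum :: "(real ^ 'd \<Rightarrow> real) \<Rightarrow> 'd \<Rightarrow> 'd list \<Rightarrow> real" where
  "occ_sum f a [] = 0"
| "occ_sum f a (b # w) = (if b = a then f 0 else 0) + occ_sum (\<lambda>x. f (disp [b] + x)) a w"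

lemma disp_Cons: "disp (b # w) = disp [b] + disp w"
  using disp_append[of "[b]" w] by simp

lemma occ_sum_append:
  "occ_sum f a (v @ w) = occ_sum f a v + occ_sum (\<lambda>x. f (disp v + x)) a w"
proof (induction v arbitrary: f)
  case (Cons b v)
  show ?case by (simp add: Cons disp_Cons[of b v] add.assoc)
qed simp

lemma occ_sum_eq_sum:
  "occ_sum f a w = (\<Sum>m | m < length w \<and> w ! m = a. f (disp (take m w)))"
proof -
  have "occ_sum f a w = (\<Sum>m<length w. if w ! m = a then f (disp (take m w)) else 0)"
  proof (induction w arbitrary: f)
    case (Cons b w)
    show ?case
      by (simp add: Cons sum.lessThan_Suc_shift disp_Cons[of b "take _ w"] del: sum.lessThan_Suc cong: if_cong)
  qed simp
  also have "\<dots> = (\<Sum>m | m < length w \<and> w ! m = a. f (disp (take m w)))"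
    by (simp add: sum.If_cases Int_def)
  finally show ?thesis .
qed

lemma abs_occ_sum_diff:
  assumes "\<And>m. \<bar>f (disp (take m w)) - g (disp (take m w))\<bar> \<le> \<epsilon>"
  shows "\<bar>occ_sum f a w - occ_sum g a w\<bar> \<le> \<epsilon> * length w"
proof -
  have "\<epsilon> \<ge> 0" using order_trans[OF abs_ge_zero assms] .
  have "\<bar>occ_sum f a w - occ_sum g a w\<bar> \<le> (\<Sum>m | m < length w \<and> w ! m = a. \<epsilon>)"
    unfolding occ_sum_eq_sum sum_subtractf[symmetric] by (rule order_trans[OF sum_abs sum_mono]) (rule assms)
  also have "\<dots> \<le> \<epsilon> * length w"
    using card_mono[of "{..<length w}" "{m. m < length w \<and> w ! m = a}"] \<open>\<epsilon> \<ge> 0\<close>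
    by (simp add: subset_eq mult.commute[of \<epsilon>] mult_right_mono)
  finally show ?thesis .
qed

lemma occ_sum_zero [simp]: "occ_sum (\<lambda>_. 0) a w = 0"
  by (simp add: occ_sum_eq_sum)

lemma abs_occ_sum_le:
  assumes "\<And>x. \<bar>f x\<bar> \<le> G"
  shows "\<bar>occ_sum f a w\<bar> \<le> G * length w"
  using abs_occ_sum_diff[of f w "\<lambda>_. 0" G a] assms by simp

text \<open>
  Each block contributes as if it were placed at the origin, up to the oscillation of \<open>f\<close> caused by
  the displacement of its starting point. The offset \<open>y\<close> is there for the induction.
\<close>

lemma occ_sum_concat_approx:
  assumes "\<And>j m. j < length vs \<Longrightarrow>
    \<bar>f (y + disp (concat (take j vs)) + disp (take m (vs ! j))) - f (disp (take m (vs ! j)))\<bar> \<le> \<epsilon>"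
  shows "\<bar>occ_sum (\<lambda>x. f (y + x)) a (concat vs) - (\<Sum>v\<leftarrow>vs. occ_sum f a v)\<bar> \<le> \<epsilon> * length (concat vs)"
  using assms
proof (induction vs arbitrary: y)
  case (Cons v vs)
  have "\<bar>occ_sum (\<lambda>x. f (y + x)) a v - occ_sum f a v\<bar> \<le> \<epsilon> * length v"
    by (rule abs_occ_sum_diff) (use Cons.prems[of 0] in simp)
  moreover have "\<bar>occ_sum (\<lambda>x. f ((y + disp v) + x)) a (concat vs) - (\<Sum>v\<leftarrow>vs. occ_sum f a v)\<bar>
      \<le> \<epsilon> * length (concat vs)"
    by (rule Cons.IH) (use Cons.prems[of "Suc _"] in \<open>simp add: add.assoc\<close>)
  ultimately show ?case by (simp add: occ_sum_append add.assoc algebra_simps)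
qed simp

end

section \<open>Integrals of bounded continuous functions\<close>

lemma measurable_of_continuous:
  fixes f :: "'a::topological_space \<Rightarrow> real"
  shows "continuous_on UNIV f \<Longrightarrow> f \<in> borel_measurable borel"
  by (rule borel_measurable_continuous_onI)

text \<open>
  The indicator of a closed set is the limit of the continuous functions \<open>max 0 (1 - n d(x, X))\<close>, and
  the closed sets are an intersection-stable generator of the Borel sets.
\<close>

lemma finite_measure_eqI_continuous:
  fixes M N :: "'a::metric_space measure"
  assumes M: "finite_measure M" "sets M = sets borel" and N: "finite_measure N" "sets N = sets borel"
    and eq: "\<And>f :: 'a \<Rightarrow> real. continuous_on UNIV f \<Longrightarrow> bounded (range f) \<Longrightarrow> (\<integral>x. f x \<partial>M) = (\<integral>x. f x \<partial>N)"
  shows "M = N"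
proof (rule measure_eqI_generator_eq[where E = "Collect closed" and \<Omega> = UNIV and A = "\<lambda>_. UNIV"])
  have sb: "sets (borel :: 'a measure) = sigma_sets UNIV (Collect closed)"
    by (simp add: borel_eq_closed)
  show "sets M = sigma_sets UNIV (Collect closed)" "sets N = sigma_sets UNIV (Collect closed)"
    using M N sb by simp_all
  show "Int_stable (Collect closed :: 'a set set)" by (auto simp: Int_stable_def)
  show "emeasure M UNIV \<noteq> \<infinity>" using M(1) by (simp add: finite_measure.emeasure_finite)
  fix X :: "'a set" assume "X \<in> Collect closed"
  then have X: "closed X" by simp
  show "emeasure M X = emeasure N X"
  proof (cases "X = {}")
    case False
    define h :: "nat \<Rightarrow> 'a \<Rightarrow> real" where "h = (\<lambda>n x. max 0 (1 - real n * infdist x X))"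
    have h: "continuous_on UNIV (h n)" "range (h n) \<subseteq> {0..1}" for n
      by (auto simp: h_def infdist_nonneg intro!: continuous_intros)
    then have hb: "bounded (range (h n))" for n using bounded_subset[OF bounded_closed_interval] by blast
    have lim: "(\<lambda>n. h n x) \<longlonglongrightarrow> indicator X x" for x
    proof (cases "x \<in> X")
      case True
      then show ?thesis by (simp add: h_def)
    next
      case nx: False
      have "infdist x X > 0" using X False nx in_closed_iff_infdist_zero infdist_nonneg by (metis less_eq_real_def)
      then obtain n0 where n0: "real n0 * infdist x X > 1" using reals_Archimedean3 by blast
      have "\<forall>\<^sub>F n in sequentially. h n x = indicator X x"
      proof (rule eventually_sequentiallyI[of n0])
        fix n assume "n0 \<le> n"
        then have "real n0 * infdist x X \<le> real n * infdist x X" by (intro mult_right_mono) (auto simp: infdist_nonneg)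
        then show "h n x = indicator X x" using n0 nx by (simp add: h_def)
      qed
      then show ?thesis by (rule tendsto_eventually)
    qed
    have conv: "(\<lambda>n. \<integral>x. h n x \<partial>K) \<longlonglongrightarrow> measure K X" if K: "finite_measure K" "sets K = sets borel" for K
    proof -
      interpret finite_measure K by fact
      have "(\<lambda>n. \<integral>x. h n x \<partial>K) \<longlonglongrightarrow> (\<integral>x. indicator X x \<partial>K)"
      proof (rule integral_dominated_convergence[where w = "\<lambda>_. 1"])
        show "h n \<in> borel_measurable K" for n
          using measurable_of_continuous[OF h(1)] K by (simp cong: measurable_cong_sets)
        show "(indicator X :: 'a \<Rightarrow> real) \<in> borel_measurable K"
          using X K by (intro borel_measurable_indicator) simp
        show "AE x in K. norm (h n x) \<le> 1" for n using h(2)[of n] by (auto simp: image_subset_iff)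
      qed (use lim in auto)
      moreover have "X \<inter> space K = X" using sets_eq_imp_space_eq[OF K(2)] by simp
      ultimately show ?thesis by simp
    qed
    have "measure M X = measure N X"
      using LIMSEQ_unique[OF conv[OF M]] conv[OF N] eq[OF h(1) hb] by simp
    then show ?thesis using M(1) N(1) by (simp add: finite_measure.emeasure_eq_measure)
  qed simp
qed auto

lemma integral_scale_measure:
  fixes f :: "'a \<Rightarrow> real"
  assumes "r \<ge> 0" "f \<in> borel_measurable M"
  shows "(\<integral>x. f x \<partial>scale_measure (ennreal r) M) = r * (\<integral>x. f x \<partial>M)"
proof -
  have "scale_measure (ennreal r) M = density M (\<lambda>_. ennreal r)"
    by (rule measure_eqI) (auto simp: emeasure_density nn_integral_cmult_indicator)
  then show ?thesis using assms by (simp add: integral_density)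
qed

text \<open>
  A sequence of independent samples is a first sample followed by an independent sequence with the
  same law. Adding the bound \<open>B\<close> reduces the claim to non-negative functions.
\<close>

lemma (in prob_space) integral_stream_space:
  fixes f :: "'a stream \<Rightarrow> real"
  assumes [measurable]: "f \<in> borel_measurable (stream_space M)" and bd: "\<And>\<omega>. \<bar>f \<omega>\<bar> \<le> B"
  shows "(\<integral>\<omega>. f \<omega> \<partial>stream_space M) = (\<integral>x. (\<integral>\<omega>. f (x ## \<omega>) \<partial>stream_space M) \<partial>M)"
proof -
  interpret S: prob_space "stream_space M" by (rule prob_space_stream_space)
  have "B \<ge> 0" using order_trans[OF abs_ge_zero bd] .
  let ?g = "\<lambda>\<omega>. f \<omega> + B"
  have g: "0 \<le> ?g \<omega>" "\<bar>?g \<omega>\<bar> \<le> 2 * B" for \<omega> using bd[of \<omega>] by (auto simp: abs_le_iff)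
  have m: "(\<lambda>x. \<integral>\<omega>. f (x ## \<omega>) \<partial>stream_space M) \<in> borel_measurable M"
    by (intro S.borel_measurable_lebesgue_integral) measurable
  have int: "integrable (stream_space M) (\<lambda>\<omega>. f (x ## \<omega>))" if "x \<in> space M" for x
    using that bd by (intro S.integrable_const_bound[of _ B]) auto
  have intf: "integrable (stream_space M) f"
    using bd by (intro S.integrable_const_bound[of _ B]) auto
  have Bd: "\<bar>\<integral>\<omega>. f (x ## \<omega>) \<partial>stream_space M\<bar> \<le> B" if "x \<in> space M" for x
  proof -
    have "\<bar>\<integral>\<omega>. f (x ## \<omega>) \<partial>stream_space M\<bar> \<le> (\<integral>\<omega>. \<bar>f (x ## \<omega>)\<bar> \<partial>stream_space M)"
      by (rule integral_abs_bound)
    also have "\<dots> \<le> (\<integral>\<omega>. B \<partial>stream_space M)"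
      using int[OF that] bd by (intro integral_mono) auto
    finally show ?thesis by (simp add: S.prob_space)
  qed
  have Bd0: "0 \<le> (\<integral>\<omega>. f (x ## \<omega>) \<partial>stream_space M) + B" if "x \<in> space M" for x
    using Bd[OF that] by linarith
  have intI: "integrable M (\<lambda>x. \<integral>\<omega>. f (x ## \<omega>) \<partial>stream_space M)"
    using Bd m by (intro integrable_const_bound[of _ B]) auto
  have "ennreal (\<integral>\<omega>. ?g \<omega> \<partial>stream_space M) = (\<integral>\<^sup>+\<omega>. ennreal (?g \<omega>) \<partial>stream_space M)"
    using g intf by (subst nn_integral_eq_integral) auto
  also have "\<dots> = (\<integral>\<^sup>+x. (\<integral>\<^sup>+\<omega>. ennreal (?g (x ## \<omega>)) \<partial>stream_space M) \<partial>M)"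
    by (rule nn_integral_stream_space) measurable
  also have "\<dots> = (\<integral>\<^sup>+x. ennreal (\<integral>\<omega>. ?g (x ## \<omega>) \<partial>stream_space M) \<partial>M)"
    using g int by (intro nn_integral_cong nn_integral_eq_integral) auto
  also have "\<dots> = (\<integral>\<^sup>+x. ennreal ((\<integral>\<omega>. f (x ## \<omega>) \<partial>stream_space M) + B) \<partial>M)"
    using int by (intro nn_integral_cong) (simp add: S.prob_space)
  also have "\<dots> = ennreal (\<integral>x. (\<integral>\<omega>. f (x ## \<omega>) \<partial>stream_space M) + B \<partial>M)"
    using Bd0 intI by (intro nn_integral_eq_integral AE_I2) auto
  finally have "(\<integral>\<omega>. ?g \<omega> \<partial>stream_space M) = (\<integral>x. (\<integral>\<omega>. f (x ## \<omega>) \<partial>stream_space M) + B \<partial>M)"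
    using Bd0 g by (subst (asm) ennreal_inj) (auto intro!: integral_nonneg_AE AE_I2)
  then show ?thesis using intf intI by (simp add: prob_space S.prob_space)
qed

context pisot_substitution
begin

lemma integral_occurrence_measure:
  assumes [measurable]: "f \<in> borel_measurable borel"
  shows "(\<integral>x. f x \<partial>occurrence_measure L R a w) = occ_sum f a w"
  unfolding occurrence_measure_def
  by (subst integral_distr) (simp_all add: lebesgue_integral_count_space_finite occ_sum_eq_sum disp_def)

lemma sets_occurrence_measure: "sets (occurrence_measure L R a w) = sets borel"
  by (simp add: occurrence_measure_def)

lemma sets_expected_occurrence_measure: "sets (expected_occurrence_measure P L R a n u) = sets borel"
  using sets.sigma_sets_eq[of "borel :: (real ^ 'd) measure"]
  by (simp add: expected_occurrence_measure_def sets_measure_of_conv)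

lemma integral_expected_occurrence_measure:
  assumes [measurable]: "f \<in> borel_measurable borel"
  shows "(\<integral>x. f x \<partial>expected_occurrence_measure P L R a n u) =
    measure_pmf.expectation (subst_iter P n u) (occ_sum f a)"
proof -
  let ?p = "subst_iter P n u"
  let ?O = "\<lambda>w. {m. m < length w \<and> w ! m = a}"
  define S where "S = Sigma (set_pmf ?p) ?O"
  \<comment> \<open>the expected measure is the image of a weighted counting measure on the pairs of a word and a position\<close>
  let ?N = "point_measure S (\<lambda>(w, m). ennreal (pmf ?p w))"
  let ?g = "\<lambda>(w, m). disp (take m w)"
  have fin: "finite S" "finite (set_pmf ?p)" "\<And>w. finite (?O w)"
    by (auto simp: S_def finite_images_iter)
  have eq: "expected_occurrence_measure P L R a n u = distr ?N borel ?g"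
  proof (rule measure_eqI)
    fix A assume "A \<in> sets (expected_occurrence_measure P L R a n u)"
    then have A: "A \<in> sets borel" by (simp add: sets_expected_occurrence_measure)
    have "emeasure (distr ?N borel ?g) A = (\<Sum>(w, m)\<in>S. ennreal (pmf ?p w) * indicator A (disp (take m w)))"
      using fin A by (subst emeasure_distr)
        (auto simp: space_point_measure emeasure_point_measure_finite sum.If_cases Int_def indicator_def
           if_distrib[of "\<lambda>c. _ * c"] case_prod_beta conj_commute cong: if_cong intro!: sum.cong)
    also have "\<dots> = (\<Sum>w\<in>set_pmf ?p. \<Sum>m\<in>?O w. ennreal (pmf ?p w) * indicator A (disp (take m w)))"
      unfolding S_def using fin by (subst sum.Sigma) auto
    also have "\<dots> = (\<Sum>w\<in>set_pmf ?p. emeasure (occurrence_measure L R a w) A * ennreal (pmf ?p w))"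
      using A by (simp add: emeasure_occurrence_measure sum_distrib_left mult.commute flip: disp_def)
    also have "\<dots> = emeasure (expected_occurrence_measure P L R a n u) A"
      using A fin by (simp add: emeasure_expected_occurrence_measure nn_integral_measure_pmf_finite)
    finally show "emeasure (expected_occurrence_measure P L R a n u) A = emeasure (distr ?N borel ?g) A" by simp
  qed (simp add: sets_expected_occurrence_measure)
  have pm: "?N = point_measure S (\<lambda>z. ennreal (pmf ?p (fst z)))" by (simp add: case_prod_unfold)
  have "(\<integral>x. f x \<partial>expected_occurrence_measure P L R a n u) = (\<Sum>(w, m)\<in>S. pmf ?p w * f (disp (take m w)))"
    unfolding eq pm using fin
    by (subst integral_distr) (auto simp: lebesgue_integral_point_measure_finite case_prod_beta)
  also have "\<dots> = (\<Sum>w\<in>set_pmf ?p. \<Sum>m\<in>?O w. pmf ?p w * f (disp (take m w)))"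
    unfolding S_def using fin by (subst sum.Sigma) auto
  also have "\<dots> = (\<Sum>w\<in>set_pmf ?p. pmf ?p w * occ_sum f a w)"
    by (simp add: occ_sum_eq_sum sum_distrib_left)
  also have "\<dots> = measure_pmf.expectation ?p (occ_sum f a)"
    using fin by (subst integral_measure_pmf[of "set_pmf ?p"]) auto
  finally show ?thesis .
qed

end

section \<open>The Rauzy measure as the law of a random series\<close>

context pisot_substitution
begin

definition mean_occ_sum :: "nat \<Rightarrow> (real ^ 'd \<Rightarrow> real) \<Rightarrow> 'd \<Rightarrow> 'd \<Rightarrow> real" where
  "mean_occ_sum n f a b = measure_pmf.expectation (subst_iter P n [b]) (occ_sum f a)"

text \<open>
  The weights \<open>R\<^sub>b\<close> are the asymptotic frequencies of the letters.
\<close>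

definition pf_mean_occ_sum :: "nat \<Rightarrow> (real ^ 'd \<Rightarrow> real) \<Rightarrow> 'd \<Rightarrow> real" where
  "pf_mean_occ_sum n f a = (\<Sum>b\<in>UNIV. R $ b * mean_occ_sum n f a b)"

definition image_mean :: "(real ^ 'd \<Rightarrow> real) \<Rightarrow> 'd \<Rightarrow> 'd \<Rightarrow> real" where
  "image_mean f a c = measure_pmf.expectation (P c) (occ_sum f a)"

lemma image_mean_altdef:
  "image_mean f a c = (\<Sum>v\<in>set_pmf (P c). pmf (P c) v * (\<Sum>m | m < length v \<and> v ! m = a. f (disp (take m v))))"
  unfolding image_mean_def
  by (subst integral_measure_pmf[of "set_pmf (P c)"]) (simp_all add: finite_images occ_sum_eq_sum)

lemma continuous_M: "continuous_on UNIV (\<lambda>x. M *v x)"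
  by (intro linear_continuous_on matrix_vector_mul_bounded_linear)

lemma continuous_image_mean:
  assumes "continuous_on UNIV f"
  shows "continuous_on UNIV (\<lambda>x. image_mean (\<lambda>y. f (M *v x + y)) a c)"
proof -
  have "continuous_on UNIV (\<lambda>x. f (M *v x + y))" for y
    by (rule continuous_on_compose2[OF assms continuous_on_add[OF continuous_M continuous_on_const]]) auto
  then show ?thesis unfolding image_mean_altdef by (intro continuous_intros)
qed

lemma image_mean_uniformly_bounded:
  assumes "G \<ge> 0"
  shows "\<exists>G'. \<forall>g a c. (\<forall>x. \<bar>g x\<bar> \<le> G) \<longrightarrow> \<bar>image_mean g a c\<bar> \<le> G'"
proof -
  define N where "N = Max (length ` (\<Union>b. set_pmf (P b)))"
  have N: "length v \<le> N" if "v \<in> set_pmf (P b)" for v b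
    unfolding N_def using that finite_images by (intro Max_ge) auto
  have "\<bar>image_mean g a c\<bar> \<le> G * N" if g: "\<And>x. \<bar>g x\<bar> \<le> G" for g a c
  proof -
    have "\<bar>image_mean g a c\<bar> \<le> measure_pmf.expectation (P c) (\<lambda>v. \<bar>occ_sum g a v\<bar>)"
      unfolding image_mean_def by (rule integral_abs_bound)
    also have "\<dots> \<le> measure_pmf.expectation (P c) (\<lambda>_. G * real N)"
    proof (rule integral_mono_AE)
      show "AE v in P c. \<bar>occ_sum g a v\<bar> \<le> G * real N"
      proof (rule AE_pmfI)
        fix v assume "v \<in> set_pmf (P c)"
        then have "G * length v \<le> G * N" using N[of v c] assms by (intro mult_left_mono) auto
        then show "\<bar>occ_sum g a v\<bar> \<le> G * real N" using abs_occ_sum_le[of g G a v, OF g] by linarith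
      qed
    qed (simp_all add: integrable_measure_pmf_finite finite_images)
    finally show ?thesis by simp
  qed
  then show ?thesis by blast
qed

text \<open>
  An occurrence of \<open>a\<close> in the image of \<open>w\<close> lies in the image of some letter \<open>c\<close> of \<open>w\<close>, and if \<open>c\<close> is
  at the point \<open>x\<close>, its image starts at \<open>M x\<close>.
\<close>

lemma expectation_subst_word_occ_sum:
  "measure_pmf.expectation (subst_word P w) (occ_sum f a) =
    (\<Sum>c\<in>UNIV. occ_sum (\<lambda>x. image_mean (\<lambda>y. f (M *v x + y)) a c) c w)"
proof (induction w arbitrary: f)
  case (Cons b w)
  note int = integrable_measure_pmf_finite[OF finite_images]
    integrable_measure_pmf_finite[OF finite_set_subst_word[of P, OF finite_images]]
  have "measure_pmf.expectation (subst_word P (b # w)) (occ_sum f a) =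
      measure_pmf.expectation (P b) (\<lambda>v. measure_pmf.expectation (subst_word P w) (\<lambda>y. occ_sum f a (v @ y)))"
    using finite_set_subst_word[of P, OF finite_images]
    by (simp add: expectation_bind_finite finite_images)
  also have "\<dots> = measure_pmf.expectation (P b) (\<lambda>v. occ_sum f a v +
      measure_pmf.expectation (subst_word P w) (occ_sum (\<lambda>x. f (disp v + x)) a))"
    by (simp add: occ_sum_append int)
  also have "\<dots> = measure_pmf.expectation (P b) (\<lambda>v. occ_sum f a v +
      measure_pmf.expectation (subst_word P w) (occ_sum (\<lambda>x. f (M *v disp [b] + x)) a))"
  proof (rule integral_cong_AE)
    show "AE v in P b. occ_sum f a v + measure_pmf.expectation (subst_word P w) (occ_sum (\<lambda>x. f (disp v + x)) a) =
        occ_sum f a v + measure_pmf.expectation (subst_word P w) (occ_sum (\<lambda>x. f (M *v disp [b] + x)) a)"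
    proof (rule AE_pmfI)
      fix v assume "v \<in> set_pmf (P b)"
      then have "v \<in> set_pmf (subst_word P [b])" by simp
      then have "disp v = M *v disp [b]" by (rule disp_subst_word)
      then show "occ_sum f a v + measure_pmf.expectation (subst_word P w) (occ_sum (\<lambda>x. f (disp v + x)) a) =
        occ_sum f a v + measure_pmf.expectation (subst_word P w) (occ_sum (\<lambda>x. f (M *v disp [b] + x)) a)"
        by simp
    qed
  qed simp_all
  also have "\<dots> = image_mean f a b + measure_pmf.expectation (subst_word P w) (occ_sum (\<lambda>x. f (M *v disp [b] + x)) a)"
    by (simp add: image_mean_def int)
  also have "\<dots> = image_mean f a b +
      (\<Sum>c\<in>UNIV. occ_sum (\<lambda>x. image_mean (\<lambda>y. f (M *v disp [b] + (M *v x + y))) a c) c w)"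
    by (simp only: Cons.IH)
  also have "\<dots> = (\<Sum>c\<in>UNIV. occ_sum (\<lambda>x. image_mean (\<lambda>y. f (M *v x + y)) a c) c (b # w))"
    by (simp add: sum.distrib matrix_vector_right_distrib add.assoc)
  finally show ?case .
qed simp

text \<open>
  The last substitution step is split off, so that new points are \<open>M x + y\<close> with an old point \<open>x\<close>. This is
  the recursion of a graph-directed iterated function system whose vertices are the letters.
\<close>

lemma pf_mean_occ_sum_Suc:
  "pf_mean_occ_sum (Suc n) f a =
    (\<Sum>c\<in>UNIV. pf_mean_occ_sum n (\<lambda>x. image_mean (\<lambda>y. f (M *v x + y)) a c) c)"
proof -
  have "mean_occ_sum (Suc n) f a b =
      (\<Sum>c\<in>UNIV. mean_occ_sum n (\<lambda>x. image_mean (\<lambda>y. f (M *v x + y)) a c) c b)" for b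
  proof -
    have "mean_occ_sum (Suc n) f a b = measure_pmf.expectation (subst_iter P n [b])
        (\<lambda>w. measure_pmf.expectation (subst_word P w) (occ_sum f a))"
      using finite_set_subst_word[of P, OF finite_images]
      by (simp add: mean_occ_sum_def expectation_bind_finite finite_images_iter)
    then show ?thesis
      unfolding expectation_subst_word_occ_sum mean_occ_sum_def
      by (simp add: integrable_measure_pmf_finite finite_images_iter)
  qed
  then show ?thesis
    unfolding pf_mean_occ_sum_def sum_distrib_left by (subst sum.swap) (simp add: sum_distrib_left)
qed

definition branch_set :: "'d \<Rightarrow> ('d \<times> 'd list \<times> nat) set" where
  "branch_set a = (SIGMA c:UNIV. SIGMA v:set_pmf (P c). {m. m < length v \<and> v ! m = a})"

text \<open>
  A letter \<open>a\<close> in a long realisation is the letter at position \<open>m\<close> of an image \<open>v\<close> of a letter \<open>c\<close>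
  one level below. Asymptotically the triple \<open>(c, v, m)\<close> has the law below; its total mass is 1
  because \<open>R\<close> is an eigenvector of \<open>M\<close>.
\<close>

definition branch_pmf :: "'d \<Rightarrow> ('d \<times> 'd list \<times> nat) pmf" where
  "branch_pmf a = embed_pmf (\<lambda>(c, v, m).
     if (c, v, m) \<in> branch_set a then R $ c * pmf (P c) v / (lam * R $ a) else 0)"

lemma finite_branch_set: "finite (branch_set a)"
  by (auto simp: branch_set_def finite_images)

lemma sum_branch_set:
  fixes h :: "'d \<Rightarrow> 'd list \<Rightarrow> nat \<Rightarrow> real"
  shows "(\<Sum>(c, v, m)\<in>branch_set a. h c v m) =
    (\<Sum>c\<in>UNIV. \<Sum>v\<in>set_pmf (P c). \<Sum>m | m < length v \<and> v ! m = a. h c v m)"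
  unfolding branch_set_def
  by (subst sum.Sigma[symmetric]) (auto simp: finite_images case_prod_unfold sum.Sigma)

lemma sum_branch_weights:
  "(\<Sum>(c, v, m)\<in>branch_set a. R $ c * pmf (P c) v / (lam * R $ a)) = 1"
proof -
  have occ: "(\<Sum>m | m < length v \<and> v ! m = a. k) = k * M $ a $ c" if "v \<in> set_pmf (P c)" for v c and k :: real
  proof -
    have "{m. m < length v \<and> v ! m = a} = {m. m < length v \<and> a = v ! m}" by auto
    then have "card {m. m < length v \<and> v ! m = a} = count_list v a"
      using length_filter_conv_card[of "(=) a" v] by (simp add: count_list_eq_length_filter)
    moreover have "real (count_list v a) = M $ a $ c"
      using abelianisation_image[OF that, of a] by (simp add: abelianisation_def)
    ultimately show ?thesis by simp
  qed
  have "(\<Sum>(c, v, m)\<in>branch_set a. R $ c * pmf (P c) v / (lam * R $ a)) =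
      (\<Sum>c\<in>UNIV. \<Sum>v\<in>set_pmf (P c). R $ c * pmf (P c) v / (lam * R $ a) * M $ a $ c)"
    unfolding sum_branch_set by (intro sum.cong refl occ)
  also have "\<dots> = (\<Sum>c\<in>UNIV. (R $ c * M $ a $ c / (lam * R $ a)) * (\<Sum>v\<in>set_pmf (P c). pmf (P c) v))"
    by (simp add: sum_distrib_left sum_divide_distrib mult_ac)
  also have "\<dots> = (\<Sum>c\<in>UNIV. M $ a $ c * R $ c) / (lam * R $ a)"
    by (simp add: sum_pmf_eq_1 finite_images sum_divide_distrib mult.commute)
  also have "(\<Sum>c\<in>UNIV. M $ a $ c * R $ c) = lam * R $ a"
    using R_eigen by (simp add: vec_eq_iff matrix_vector_mult_def)
  finally show ?thesis using R_pos[of a] lam_gt_1 by simp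
qed

lemma pmf_branch_pmf:
  "pmf (branch_pmf a) (c, v, m) =
    (if (c, v, m) \<in> branch_set a then R $ c * pmf (P c) v / (lam * R $ a) else 0)"
proof -
  let ?w = "\<lambda>(c, v, m). if (c, v, m) \<in> branch_set a then R $ c * pmf (P c) v / (lam * R $ a) else 0"
  have nn: "0 \<le> ?w z" for z
    using R_pos[THEN less_imp_le] lam_gt_1 by (auto simp: case_prod_unfold)
  have "(\<integral>\<^sup>+z. ennreal (?w z) \<partial>count_space UNIV) = (\<Sum>z\<in>branch_set a. ennreal (?w z))"
    by (rule nn_integral_count_space'[OF finite_branch_set]) auto
  also have "\<dots> = ennreal (\<Sum>z\<in>branch_set a. ?w z)" using nn by (intro sum_ennreal) auto
  also have "(\<Sum>z\<in>branch_set a. ?w z) = 1"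
    unfolding sum_branch_weights[of a, symmetric] by (intro sum.cong) auto
  finally show ?thesis
    unfolding branch_pmf_def using pmf_embed_pmf[of ?w "(c, v, m)"] nn by simp
qed

lemma expectation_branch_pmf:
  fixes h :: "'d \<Rightarrow> 'd list \<Rightarrow> nat \<Rightarrow> real"
  shows "measure_pmf.expectation (branch_pmf a) (\<lambda>(c, v, m). h c v m) =
    (\<Sum>c\<in>UNIV. R $ c * (\<Sum>v\<in>set_pmf (P c). pmf (P c) v * (\<Sum>m | m < length v \<and> v ! m = a. h c v m))) / (lam * R $ a)"
proof -
  have "measure_pmf.expectation (branch_pmf a) (\<lambda>(c, v, m). h c v m) =
      (\<Sum>z\<in>branch_set a. pmf (branch_pmf a) z *\<^sub>R (case z of (c, v, m) \<Rightarrow> h c v m))"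
    by (rule integral_measure_pmf[OF finite_branch_set]) (auto simp: set_pmf_iff pmf_branch_pmf split: if_splits)
  also have "\<dots> = (\<Sum>(c, v, m)\<in>branch_set a. R $ c * pmf (P c) v / (lam * R $ a) * h c v m)"
    by (intro sum.cong) (auto simp: pmf_branch_pmf)
  also have "\<dots> = (\<Sum>c\<in>UNIV. \<Sum>v\<in>set_pmf (P c). \<Sum>m | m < length v \<and> v ! m = a.
      R $ c * pmf (P c) v / (lam * R $ a) * h c v m)"
    by (rule sum_branch_set)
  finally show ?thesis by (simp add: sum_distrib_left sum_divide_distrib mult_ac)
qed

text \<open>
  The default value for words that are no images makes the offsets bounded everywhere and not only almost
  surely.
\<close>

definition branch_offset :: "'d list \<Rightarrow> nat \<Rightarrow> real ^ 'd" where
  "branch_offset v m = (if v \<in> (\<Union>b. set_pmf (P b)) then disp (take m v) else 0)"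

text \<open>
  Drawing a branch for every letter at once makes the draws of the different levels independent and
  identically distributed, although the letters visited form a Markov chain.
\<close>

abbreviation branch_choice :: "('d \<Rightarrow> 'd \<times> 'd list \<times> nat) pmf" where
  "branch_choice \<equiv> Pi_pmf UNIV undefined branch_pmf"

abbreviation branch_stream :: "('d \<Rightarrow> 'd \<times> 'd list \<times> nat) stream measure" where
  "branch_stream \<equiv> stream_space (measure_pmf branch_choice)"

text \<open>
  The \<open>n\<close>-th partial sum of \<open>t\<^sub>0 + M t\<^sub>1 + M\<^sup>2 t\<^sub>2 + \<dots>\<close>, where \<open>t\<^sub>i\<close> is the offset of the branch chosen at
  level \<open>i\<close> for the letter reached there from \<open>a\<close>.
\<close>

primrec address_point :: "nat \<Rightarrow> 'd \<Rightarrow> ('d \<Rightarrow> 'd \<times> 'd list \<times> nat) stream \<Rightarrow> real ^ 'd" where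
  "address_point 0 a \<omega> = 0"
| "address_point (Suc n) a \<omega> =
    (case shd \<omega> a of (c, v, m) \<Rightarrow> branch_offset v m + M *v address_point n c (stl \<omega>))"

definition limit_point :: "'d \<Rightarrow> ('d \<Rightarrow> 'd \<times> 'd list \<times> nat) stream \<Rightarrow> real ^ 'd" where
  "limit_point a \<omega> = lim (\<lambda>n. address_point n a \<omega>)"

sublocale branch: prob_space branch_stream
  by (rule prob_space.prob_space_stream_space[OF measure_pmf.prob_space_axioms])

lemma measurable_address_point [measurable]: "address_point n a \<in> borel_measurable branch_stream"
proof (induction n arbitrary: a)
  case 0
  have "address_point 0 a = (\<lambda>_. 0)" by auto
  then show ?case by simp
next
  case (Suc n)
  have lin: "(\<lambda>x. M *v x) \<in> borel_measurable borel"
    by (rule borel_measurable_continuous_onI[OF continuous_M])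
  have "(\<lambda>\<omega>. (\<lambda>z \<omega>. case z of (c, v, m) \<Rightarrow> branch_offset v m + M *v address_point n c (stl \<omega>)) (shd \<omega> a) \<omega>)
      \<in> borel_measurable branch_stream"
  proof (rule measurable_compose_countable)
    fix z :: "'d \<times> 'd list \<times> nat"
    obtain c v m where z: "z = (c, v, m)" by (cases z)
    show "(\<lambda>\<omega>. case z of (c, v, m) \<Rightarrow> branch_offset v m + M *v address_point n c (stl \<omega>))
        \<in> borel_measurable branch_stream"
      using measurable_compose[OF measurable_compose[OF measurable_stl Suc[of c]] lin]
      by (simp add: z borel_measurable_add)
    show "(\<lambda>\<omega>. shd \<omega> a) \<in> measurable branch_stream (count_space UNIV)"
      by (rule measurable_compose[OF measurable_shd]) simp
  qed
  moreover have "address_point (Suc n) a =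
      (\<lambda>\<omega>. case shd \<omega> a of (c, v, m) \<Rightarrow> branch_offset v m + M *v address_point n c (stl \<omega>))"
    by auto
  ultimately show ?case by simp
qed

text \<open>
  The increment is \<open>M\<^sup>n\<close> applied to an offset. As \<open>M\<close> need not contract in one step, the induction
  carries an additional power \<open>M\<^sup>i\<close>.
\<close>

lemma address_point_increment_bound:
  "\<exists>B \<rho>. 0 \<le> \<rho> \<and> \<rho> < 1 \<and>
     (\<forall>n a \<omega>. norm (address_point (Suc n) a \<omega> - address_point n a \<omega>) \<le> B * \<rho> ^ n)"
proof -
  obtain \<rho> C where \<rho>: "0 \<le> \<rho>" "\<rho> < 1" "0 \<le> C"
    and C: "\<And>n x. L \<bullet> x = 0 \<Longrightarrow> norm (Mpow n x) \<le> C * norm x * \<rho> ^ n"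
    using contraction by metis
  obtain T where T: "T \<ge> 0" "\<And>b v m. v \<in> set_pmf (P b) \<Longrightarrow> norm (disp (take m v)) \<le> T"
    using image_prefix_bound by blast
  have off: "norm (branch_offset v m) \<le> T" "L \<bullet> branch_offset v m = 0" for v m
    using T by (auto simp: branch_offset_def)
  have "norm (Mpow i (address_point (Suc n) a \<omega> - address_point n a \<omega>)) \<le> C * T * \<rho> ^ (n + i)" for n i a \<omega>
  proof (induction n arbitrary: i a \<omega>)
    case 0
    obtain c v m where z: "shd \<omega> a = (c, v, m)" by (cases "shd \<omega> a")
    have "norm (Mpow i (branch_offset v m)) \<le> C * norm (branch_offset v m) * \<rho> ^ i" by (rule C[OF off(2)])
    also have "\<dots> \<le> C * T * \<rho> ^ i" using off(1) \<rho> by (intro mult_right_mono mult_left_mono) auto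
    finally show ?case using z by simp
  next
    case (Suc n)
    obtain c v m where z: "shd \<omega> a = (c, v, m)" by (cases "shd \<omega> a")
    have "address_point (Suc (Suc n)) a \<omega> - address_point (Suc n) a \<omega> =
        M *v (address_point (Suc n) c (stl \<omega>) - address_point n c (stl \<omega>))"
      using z by (simp add: matrix_vector_mult_diff_distrib del: address_point.simps(2)
        add: address_point.simps(2)[of _ a \<omega>])
    then have "Mpow i (address_point (Suc (Suc n)) a \<omega> - address_point (Suc n) a \<omega>) =
        Mpow (Suc i) (address_point (Suc n) c (stl \<omega>) - address_point n c (stl \<omega>))"
      by (simp add: funpow_swap1)
    then show ?case using Suc.IH[of "Suc i" c "stl \<omega>"] by simp
  qed
  from this[of 0] show ?thesis using \<rho> by (intro exI[of _ "C * T"] exI[of _ \<rho>]) auto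
qed

lemma address_point_tendsto: "(\<lambda>n. address_point n a \<omega>) \<longlonglongrightarrow> limit_point a \<omega>"
proof -
  obtain B \<rho> where \<rho>: "0 \<le> \<rho>" "\<rho> < 1"
    and B: "\<And>n a \<omega>. norm (address_point (Suc n) a \<omega> - address_point n a \<omega>) \<le> B * \<rho> ^ n"
    using address_point_increment_bound by blast
  have "summable (\<lambda>n. address_point (Suc n) a \<omega> - address_point n a \<omega>)"
    by (rule summable_comparison_test'[of "\<lambda>n. B * \<rho> ^ n" 0])
      (use \<rho> B in \<open>auto intro: summable_mult summable_geometric\<close>)
  then have "convergent (\<lambda>n. address_point n a \<omega>)"
    by (simp add: summable_iff_convergent sum_lessThan_telescope[of "\<lambda>n. address_point n a \<omega>"] del: address_point.simps(2))
  then show ?thesis by (simp add: limit_point_def convergent_LIMSEQ_iff)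
qed

lemma measurable_limit_point [measurable]: "limit_point a \<in> borel_measurable branch_stream"
  by (rule borel_measurable_LIMSEQ_metric[OF measurable_address_point address_point_tendsto])

text \<open>
  Both sides satisfy the same recursion: conditioning on the first draw on the left corresponds to
  \<open>pf_mean_occ_sum_Suc\<close> on the right.
\<close>

lemma integral_address_point:
  assumes "continuous_on UNIV f" "\<And>x. \<bar>f x\<bar> \<le> G"
  shows "R $ a * (\<integral>\<omega>. f (address_point n a \<omega>) \<partial>branch_stream) = pf_mean_occ_sum n f a / lam ^ n"
  using assms
proof (induction n arbitrary: f a G)
  case 0
  have "mean_occ_sum 0 f a b = (if b = a then f 0 else 0)" for b by (simp add: mean_occ_sum_def)
  then show ?case
    by (simp add: pf_mean_occ_sum_def if_distrib[of "\<lambda>c. _ * c"] branch.prob_space cong: if_cong)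
next
  case (Suc n)
  have f[measurable]: "f \<in> borel_measurable borel" using Suc.prems by (simp add: measurable_of_continuous)
  define I where "I = (\<lambda>t c. \<integral>\<omega>. f (t + M *v address_point n c \<omega>) \<partial>branch_stream)"
  define h where "h = (\<lambda>c x. image_mean (\<lambda>y. f (M *v x + y)) a c)"
  have lin[measurable]: "(\<lambda>x. M *v x) \<in> borel_measurable borel"
    by (rule borel_measurable_continuous_onI[OF continuous_M])
  have int: "integrable branch_stream (\<lambda>\<omega>. f (t + M *v address_point n c \<omega>))" for t c
    using Suc.prems(2) by (intro branch.integrable_const_bound[of _ G]) auto
  have "(\<integral>\<omega>. f (address_point (Suc n) a \<omega>) \<partial>branch_stream) =
      measure_pmf.expectation branch_choice (\<lambda>\<xi>. \<integral>\<omega>. f (address_point (Suc n) a (\<xi> ## \<omega>)) \<partial>branch_stream)"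
    by (rule prob_space.integral_stream_space[OF measure_pmf.prob_space_axioms, where B = G]) (use Suc.prems(2) in measurable)
  also have "\<dots> = measure_pmf.expectation branch_choice (\<lambda>\<xi>. case \<xi> a of (c, v, m) \<Rightarrow> I (branch_offset v m) c)"
    by (intro Bochner_Integration.integral_cong refl) (auto simp: I_def split: prod.split)
  also have "\<dots> = measure_pmf.expectation (map_pmf (\<lambda>\<xi>. \<xi> a) branch_choice) (\<lambda>(c, v, m). I (branch_offset v m) c)"
    by simp
  also have "map_pmf (\<lambda>\<xi>. \<xi> a) branch_choice = branch_pmf a"
    by (subst Pi_pmf_component) auto
  also have "measure_pmf.expectation (branch_pmf a) (\<lambda>(c, v, m). I (branch_offset v m) c) =
      (\<Sum>c\<in>UNIV. R $ c * (\<Sum>v\<in>set_pmf (P c). pmf (P c) v * (\<Sum>m | m < length v \<and> v ! m = a. I (branch_offset v m) c))) / (lam * R $ a)"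
    by (rule expectation_branch_pmf)
  also have "(\<Sum>c\<in>UNIV. R $ c * (\<Sum>v\<in>set_pmf (P c). pmf (P c) v * (\<Sum>m | m < length v \<and> v ! m = a. I (branch_offset v m) c))) =
      (\<Sum>c\<in>UNIV. R $ c * (\<integral>\<omega>. h c (address_point n c \<omega>) \<partial>branch_stream))"
  proof (intro sum.cong refl arg_cong2[of _ _ _ _ "(*)"])
    fix c
    have "(\<Sum>v\<in>set_pmf (P c). pmf (P c) v * (\<Sum>m | m < length v \<and> v ! m = a. I (branch_offset v m) c)) =
        (\<Sum>v\<in>set_pmf (P c). pmf (P c) v * (\<Sum>m | m < length v \<and> v ! m = a.
          \<integral>\<omega>. f (M *v address_point n c \<omega> + disp (take m v)) \<partial>branch_stream))"
      by (intro sum.cong refl arg_cong2[of _ _ _ _ "(*)"]) (auto simp: I_def branch_offset_def add.commute)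
    also have "\<dots> = (\<integral>\<omega>. h c (address_point n c \<omega>) \<partial>branch_stream)"
      unfolding h_def image_mean_altdef using int by (simp add: add.commute)
    finally show "(\<Sum>v\<in>set_pmf (P c). pmf (P c) v * (\<Sum>m | m < length v \<and> v ! m = a. I (branch_offset v m) c)) =
      (\<integral>\<omega>. h c (address_point n c \<omega>) \<partial>branch_stream)" .
  qed
  also have "\<dots> = (\<Sum>c\<in>UNIV. pf_mean_occ_sum n (h c) c / lam ^ n)"
  proof (intro sum.cong refl)
    fix c
    obtain G' where G': "\<forall>g a c. (\<forall>x. \<bar>g x\<bar> \<le> G) \<longrightarrow> \<bar>image_mean g a c\<bar> \<le> G'"
      using image_mean_uniformly_bounded[OF order_trans[OF abs_ge_zero Suc.prems(2)]] by (rule exE)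
    have "\<bar>h c x\<bar> \<le> G'" for x unfolding h_def by (rule G'[rule_format]) (rule Suc.prems)
    then show "R $ c * (\<integral>\<omega>. h c (address_point n c \<omega>) \<partial>branch_stream) = pf_mean_occ_sum n (h c) c / lam ^ n"
      using continuous_image_mean[OF Suc.prems(1)] by (intro Suc.IH) (auto simp: h_def)
  qed
  also have "\<dots> = pf_mean_occ_sum (Suc n) f a / lam ^ n"
    by (simp add: pf_mean_occ_sum_Suc h_def sum_divide_distrib)
  finally show ?case using R_pos[of a] by (simp add: field_simps)
qed

text \<open>
  This is the Rauzy measure of the letter \<open>a\<close>; its total mass is the frequency of \<open>a\<close>.
\<close>

definition limit_measure :: "'d \<Rightarrow> (real ^ 'd) measure" where
  "limit_measure a = scale_measure (ennreal (R $ a)) (distr branch_stream borel (limit_point a))"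

lemma sets_limit_measure: "sets (limit_measure a) = sets borel"
  by (simp add: limit_measure_def)

lemma finite_limit_measure: "finite_measure (limit_measure a)"
proof -
  interpret D: prob_space "distr branch_stream borel (limit_point a)" by (rule branch.prob_space_distr) simp
  show ?thesis
    by (rule finite_measureI)
      (simp add: limit_measure_def space_scale_measure D.emeasure_eq_measure ennreal_mult_eq_top_iff del: space_distr)
qed

lemma pf_mean_occ_sum_tendsto:
  assumes f: "continuous_on UNIV f" "bounded (range f)"
  shows "(\<lambda>n. pf_mean_occ_sum n f a / lam ^ n) \<longlonglongrightarrow> (\<integral>x. f x \<partial>limit_measure a)"
proof -
  have m[measurable]: "f \<in> borel_measurable borel" using f by (simp add: measurable_of_continuous)
  obtain G where G: "\<And>x. \<bar>f x\<bar> \<le> G" using f(2) by (auto simp: bounded_iff)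
  have "(\<lambda>n. \<integral>\<omega>. f (address_point n a \<omega>) \<partial>branch_stream) \<longlonglongrightarrow> (\<integral>\<omega>. f (limit_point a \<omega>) \<partial>branch_stream)"
  proof (rule integral_dominated_convergence[where w = "\<lambda>_. G"])
    show "AE \<omega> in branch_stream. (\<lambda>n. f (address_point n a \<omega>)) \<longlonglongrightarrow> f (limit_point a \<omega>)"
      using f(1) address_point_tendsto
      by (intro AE_I2 isCont_tendsto_compose[of _ f]) (auto simp: continuous_on_eq_continuous_at)
  qed (use G in auto)
  then have "(\<lambda>n. R $ a * (\<integral>\<omega>. f (address_point n a \<omega>) \<partial>branch_stream)) \<longlonglongrightarrow>
      R $ a * (\<integral>\<omega>. f (limit_point a \<omega>) \<partial>branch_stream)"
    by (rule tendsto_mult_left)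
  moreover have "(\<integral>x. f x \<partial>limit_measure a) = R $ a * (\<integral>\<omega>. f (limit_point a \<omega>) \<partial>branch_stream)"
    unfolding limit_measure_def using R_pos[of a] by (simp add: integral_scale_measure integral_distr)
  ultimately show ?thesis by (simp add: integral_address_point[OF f(1) G])
qed

end

section \<open>Convergence along typical words\<close>

text \<open>
  Here \<open>n\<close> is the level at which a word is cut into blocks and \<open>k\<close> the number of levels inside a block.
\<close>

lemma LIMSEQ_by_shifted_approximation:
  fixes y :: "nat \<Rightarrow> real" and q :: "nat \<Rightarrow> nat \<Rightarrow> real"
  assumes q: "\<And>k. (\<lambda>n. q k n) \<longlonglongrightarrow> c k" and c: "c \<longlonglongrightarrow> l"
    and approx: "\<And>\<epsilon>. \<epsilon> > 0 \<Longrightarrow> \<exists>k0. \<forall>k\<ge>k0. \<forall>\<^sub>F n in sequentially. \<bar>y (n + k) - q k n\<bar> \<le> \<epsilon>"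
  shows "y \<longlonglongrightarrow> l"
proof (rule LIMSEQ_I)
  fix r :: real assume "r > 0"
  then have r: "r / 4 > 0" by simp
  obtain k0 where k0: "\<And>k. k \<ge> k0 \<Longrightarrow> \<forall>\<^sub>F n in sequentially. \<bar>y (n + k) - q k n\<bar> \<le> r / 4"
    using approx[OF r] by blast
  have "\<forall>\<^sub>F k in sequentially. \<bar>c k - l\<bar> < r / 4 \<and> k \<ge> k0"
    using tendstoD[OF c r] eventually_ge_at_top[of k0]
    by (simp add: dist_real_def eventually_conj_iff del: less_divide_eq_numeral1)
  then obtain k where k: "\<bar>c k - l\<bar> < r / 4" "k \<ge> k0" by (auto dest: eventually_happens)
  have "\<forall>\<^sub>F n in sequentially. \<bar>q k n - c k\<bar> < r / 4"
    using tendstoD[OF q[of k] r] by (simp add: dist_real_def)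
  with k0[OF k(2)] have "\<forall>\<^sub>F n in sequentially. \<bar>y (n + k) - l\<bar> < r"
  proof eventually_elim
    case (elim n)
    then show ?case using k(1) by linarith
  qed
  then have "\<forall>\<^sub>F n in sequentially. \<bar>y n - l\<bar> < r"
    by (rule eventually_sequentially_seg[of "\<lambda>n. \<bar>y n - l\<bar> < r", THEN iffD1])
  then show "\<exists>no. \<forall>n\<ge>no. norm (y n - l) < r" by (simp add: eventually_sequentially)
qed

context pisot_substitution
begin

text \<open>
  On the component of \<open>x\<close> along \<open>R\<close> the powers of \<open>M\<close> act as \<open>\<lambda>\<^sup>n\<close>, and on the complementary component
  they tend to zero.
\<close>

lemma Mpow_component_tendsto: "(\<lambda>n. Mpow n x $ i / lam ^ n) \<longlonglongrightarrow> (L \<bullet> x) * R $ i"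
proof -
  obtain \<rho> C where \<rho>: "0 \<le> \<rho>" "\<rho> < 1" "0 \<le> C"
    and C: "\<And>n x. L \<bullet> x = 0 \<Longrightarrow> norm (Mpow n x) \<le> C * norm x * \<rho> ^ n"
    using contraction by metis
  have bound: "\<bar>Mpow n x $ i / lam ^ n - (L \<bullet> x) * R $ i\<bar> \<le> C * norm (proj x) * \<rho> ^ n" for n
  proof -
    have "Mpow n x = Mpow n (proj x + (L \<bullet> x) *\<^sub>R R)" by (simp add: rauzy_proj_def)
    also have "\<dots> = Mpow n (proj x) + (L \<bullet> x) *\<^sub>R lam ^ n *\<^sub>R R"
      by (simp only: linear_add[OF linear_iterate] linear_scale[OF linear_iterate] iterate_eigenvector[OF R_eigen])
    finally have "Mpow n x $ i / lam ^ n - (L \<bullet> x) * R $ i = Mpow n (proj x) $ i / lam ^ n"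
      using lam_gt_1 by (simp add: field_simps)
    then have "\<bar>Mpow n x $ i / lam ^ n - (L \<bullet> x) * R $ i\<bar> = \<bar>Mpow n (proj x) $ i\<bar> / lam ^ n"
      using lam_gt_1 by simp
    also have "\<dots> \<le> \<bar>Mpow n (proj x) $ i\<bar>"
      using lam_gt_1 by (simp add: divide_le_eq mult_le_cancel_left1 one_le_power)
    also have "\<dots> \<le> norm (Mpow n (proj x))" by (rule component_le_norm_cart)
    also have "\<dots> \<le> C * norm (proj x) * \<rho> ^ n" by (rule C[OF inner_L_proj])
    finally show ?thesis .
  qed
  have "(\<lambda>n. C * norm (proj x) * \<rho> ^ n) \<longlonglongrightarrow> 0"
    using \<rho> by (intro tendsto_mult_right_zero LIMSEQ_power_zero) auto
  then have "(\<lambda>n. Mpow n x $ i / lam ^ n - (L \<bullet> x) * R $ i) \<longlonglongrightarrow> 0"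
    by (rule Lim_null_comparison[rotated]) (use bound in simp)
  then show ?thesis by (simp add: LIM_zero_iff)
qed

lemma iter_length_tendsto: "(\<lambda>n. iter_length P n u / lam ^ n) \<longlonglongrightarrow> L \<bullet> abelianisation u"
proof -
  have "(\<lambda>n. \<Sum>i\<in>UNIV. Mpow n (abelianisation u) $ i / lam ^ n) \<longlonglongrightarrow>
      (\<Sum>i\<in>UNIV. (L \<bullet> abelianisation u) * R $ i)"
    by (intro tendsto_sum Mpow_component_tendsto)
  then show ?thesis by (simp add: real_iter_length sum_divide_distrib R_sum flip: sum_distrib_left)
qed

lemma L_abelianisation_pos: "u \<noteq> [] \<Longrightarrow> L \<bullet> abelianisation u > 0"
proof -
  assume "u \<noteq> []"
  then have "count_list u (hd u) > 0" by (cases u) auto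
  then have "0 < L $ hd u * abelianisation u $ hd u" using L_pos by (simp add: abelianisation_def)
  also have "\<dots> \<le> (\<Sum>i\<in>UNIV. L $ i * abelianisation u $ i)"
    by (rule member_le_sum) (auto simp: abelianisation_def L_pos less_imp_le)
  finally show ?thesis by (simp add: inner_vec_def)
qed

text \<open>
  The expected sum over the blocks of level \<open>k\<close> given a realisation of \<open>\<vartheta>\<^sup>n(u)\<close>. By compatibility it
  depends only on the abelianisation and hence not on the realisation.
\<close>

definition predicted_sum :: "'d list \<Rightarrow> (real ^ 'd \<Rightarrow> real) \<Rightarrow> 'd \<Rightarrow> nat \<Rightarrow> nat \<Rightarrow> real" where
  "predicted_sum u f a k n = (\<Sum>b\<in>UNIV. Mpow n (abelianisation u) $ b * mean_occ_sum k f a b)"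

lemma predicted_sum_tendsto:
  assumes "u \<noteq> []"
  shows "(\<lambda>n. predicted_sum u f a k n / iter_length P (n + k) u) \<longlonglongrightarrow> pf_mean_occ_sum k f a / lam ^ k"
proof -
  let ?l = "L \<bullet> abelianisation u"
  have lam: "lam > 0" using lam_gt_1 by simp
  have "(\<lambda>n. \<Sum>b\<in>UNIV. Mpow n (abelianisation u) $ b / lam ^ n * mean_occ_sum k f a b) \<longlonglongrightarrow>
      (\<Sum>b\<in>UNIV. ?l * R $ b * mean_occ_sum k f a b)"
    by (intro tendsto_sum tendsto_mult_right Mpow_component_tendsto)
  then have 1: "(\<lambda>n. predicted_sum u f a k n / lam ^ n) \<longlonglongrightarrow> ?l * pf_mean_occ_sum k f a"
    by (simp add: predicted_sum_def pf_mean_occ_sum_def sum_divide_distrib sum_distrib_left mult_ac)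
  have "(\<lambda>n. lam ^ k * (iter_length P (n + k) u / lam ^ (n + k))) \<longlonglongrightarrow> lam ^ k * ?l"
    by (intro tendsto_mult_left LIMSEQ_ignore_initial_segment[OF iter_length_tendsto])
  then have 2: "(\<lambda>n. iter_length P (n + k) u / lam ^ n) \<longlonglongrightarrow> lam ^ k * ?l"
    using lam by (simp add: power_add field_simps)
  have "(\<lambda>n. (predicted_sum u f a k n / lam ^ n) / (iter_length P (n + k) u / lam ^ n)) \<longlonglongrightarrow>
      (?l * pf_mean_occ_sum k f a) / (lam ^ k * ?l)"
    by (rule tendsto_divide[OF 1 2]) (use lam L_abelianisation_pos[OF assms] in simp)
  then show ?thesis using lam L_abelianisation_pos[OF assms] by simp
qed

lemma sum_list_mean_occ_sum:
  assumes "w \<in> set_pmf (subst_iter P n u)"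
  shows "(\<Sum>b\<leftarrow>w. mean_occ_sum k f a b) = predicted_sum u f a k n"
  unfolding sum_list_letters predicted_sum_def by (simp only: abelianisation_subst_iter[OF assms])

lemma concat_blocks_in_subst_iter:
  assumes "vs \<in> set_pmf (blocks (\<lambda>b. subst_iter P k [b]) w)"
  shows "concat vs \<in> set_pmf (subst_iter P k w)"
  using assms by (subst subst_iter_eq_subst_word) (simp add: subst_word_eq_concat_blocks)

text \<open>
  The block of the letter after a prefix \<open>p\<close> starts at \<open>M\<^sup>k\<close> applied to the displacement of \<open>p\<close>, which has norm at
  most \<open>B \<rho>\<^sup>k\<close> for all prefixes and all \<open>n\<close>. All points involved lie in the ball of radius \<open>2B\<close>, on which
  \<open>f\<close> is uniformly continuous.
\<close>

lemma occ_sum_block_approx: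
  fixes \<epsilon> :: real
  assumes f: "continuous_on UNIV f" and "\<epsilon> > 0"
  shows "\<exists>k0. \<forall>k\<ge>k0. \<forall>n w vs. w \<in> set_pmf (subst_iter P n u) \<longrightarrow>
    vs \<in> set_pmf (blocks (\<lambda>b. subst_iter P k [b]) w) \<longrightarrow>
    \<bar>occ_sum f a (concat vs) - (\<Sum>v\<leftarrow>vs. occ_sum f a v)\<bar> \<le> \<epsilon> * length (concat vs)"
proof -
  obtain B \<rho> where \<rho>: "0 \<le> \<rho>" "\<rho> < 1" and B: "0 \<le> B"
    and pre: "\<And>u' n w m i. length u' \<le> max (length u) 1 \<Longrightarrow> w \<in> set_pmf (subst_iter P n u') \<Longrightarrow>
      norm (Mpow i (disp (take m w))) \<le> B * \<rho> ^ i"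
    using prefix_bound[of "max (length u) 1"] by metis
  have "uniformly_continuous_on (cball 0 (2 * B)) f"
    by (rule compact_uniformly_continuous) (auto intro: continuous_on_subset[OF f])
  then obtain \<delta> where \<delta>: "\<delta> > 0"
    "\<And>x x'. x \<in> cball 0 (2 * B) \<Longrightarrow> x' \<in> cball 0 (2 * B) \<Longrightarrow> dist x' x < \<delta> \<Longrightarrow> dist (f x') (f x) < \<epsilon>"
    using \<open>\<epsilon> > 0\<close> unfolding uniformly_continuous_on_def by metis
  have "(\<lambda>k. B * \<rho> ^ k) \<longlonglongrightarrow> 0"
    using \<rho> by (intro tendsto_mult_right_zero LIMSEQ_power_zero) auto
  then have "\<forall>\<^sub>F k in sequentially. B * \<rho> ^ k < \<delta>" using \<delta>(1) by (rule order_tendstoD)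
  then obtain k0 where k0: "\<And>k. k \<ge> k0 \<Longrightarrow> B * \<rho> ^ k < \<delta>" by (auto simp: eventually_sequentially)
  have "\<bar>occ_sum f a (concat vs) - (\<Sum>v\<leftarrow>vs. occ_sum f a v)\<bar> \<le> \<epsilon> * length (concat vs)"
    if k: "k \<ge> k0" and w: "w \<in> set_pmf (subst_iter P n u)"
      and vs: "vs \<in> set_pmf (blocks (\<lambda>b. subst_iter P k [b]) w)" for k n w vs
  proof -
    have la: "list_all2 (\<lambda>b v. v \<in> set_pmf (subst_iter P k [b])) w vs" using vs by (simp add: set_blocks)
    have "\<bar>occ_sum (\<lambda>x. f (0 + x)) a (concat vs) - (\<Sum>v\<leftarrow>vs. occ_sum f a v)\<bar> \<le> \<epsilon> * length (concat vs)"
    proof (rule occ_sum_concat_approx)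
      fix j m assume j: "j < length vs"
      let ?y = "disp (concat (take j vs))" and ?x = "disp (take m (vs ! j))"
      have "take j vs \<in> set_pmf (blocks (\<lambda>b. subst_iter P k [b]) (take j w))"
        using la by (simp add: set_blocks list_all2_takeI)
      then have "?y = Mpow k (disp (take j w))" by (intro disp_subst_iter concat_blocks_in_subst_iter)
      then have y: "norm ?y \<le> B * \<rho> ^ k" using pre[OF _ w] by simp
      have "B * \<rho> ^ k \<le> B" using B \<rho> by (simp add: mult_left_le power_le_one)
      have "vs ! j \<in> set_pmf (subst_iter P k [w ! j])" using la j by (simp add: list_all2_conv_all_nth)
      then have x: "norm ?x \<le> B" using pre[of "[w ! j]" "vs ! j" k 0 m] by simp
      have "?x \<in> cball 0 (2 * B)" using x B by simp
      moreover have "?y + ?x \<in> cball 0 (2 * B)"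
        using norm_triangle_ineq[of ?y ?x] x y \<open>B * \<rho> ^ k \<le> B\<close> by simp
      moreover have "dist (?y + ?x) ?x < \<delta>" using y k0[OF k] by (simp add: dist_norm)
      ultimately have "dist (f (?y + ?x)) (f ?x) < \<epsilon>" by (rule \<delta>(2))
      then show "\<bar>f (0 + ?y + ?x) - f ?x\<bar> \<le> \<epsilon>" by (simp add: dist_real_def)
    qed
    then show ?thesis by simp
  qed
  then show ?thesis by blast
qed

lemma subst_iter_add_blocks:
  "subst_iter P (n + k) u = bind_pmf (subst_iter P n u)
     (\<lambda>w. map_pmf concat (blocks (\<lambda>b. subst_iter P k [b]) w))"
proof -
  have "subst_iter P k = (\<lambda>w. map_pmf concat (blocks (\<lambda>b. subst_iter P k [b]) w))"
    by (rule ext) (subst subst_iter_eq_subst_word, simp add: subst_word_eq_concat_blocks)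
  then show ?thesis using subst_iter_add[of P n k u] by simp
qed

definition typical_words :: "'d list \<Rightarrow> nat \<Rightarrow> nat \<Rightarrow> real \<Rightarrow> 'd list set" where
  "typical_words u n k \<delta> = (\<Union>w\<in>set_pmf (subst_iter P n u).
     concat ` typical_blocks (\<lambda>b. subst_iter P k [b]) w \<delta>)"

text \<open>
  A typical word is one that admits some decomposition into typical blocks. Typicality is thus an
  event for the word of level \<open>n + k\<close> alone, and the bound for the blocks given the word of level \<open>n\<close>
  can be averaged over the latter.
\<close>

lemma prob_not_typical_words:
  fixes \<delta> :: real
  assumes "u \<noteq> []" "\<delta> > 0"
  shows "measure_pmf.prob (subst_iter P (n + k) u) (- typical_words u n k \<delta>)
    \<le> card (\<Union>b. set_pmf (subst_iter P k [b])) / (\<delta>\<^sup>2 * iter_length P n u)"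
proof -
  let ?Q = "\<lambda>b. subst_iter P k [b]" and ?A = "- typical_words u n k \<delta>"
  let ?c = "card (\<Union>b. set_pmf (?Q b)) / (\<delta>\<^sup>2 * iter_length P n u)"
  have le: "emeasure (map_pmf concat (blocks ?Q w)) ?A \<le> ennreal ?c" if w: "w \<in> set_pmf (subst_iter P n u)" for w
  proof -
    have "w \<noteq> []" using subst_iter_Nil_iff[OF Nil_notin_images w] assms by simp
    have "measure_pmf.prob (map_pmf concat (blocks ?Q w)) ?A = measure_pmf.prob (blocks ?Q w) (concat -` ?A)"
      by simp
    also have "\<dots> \<le> measure_pmf.prob (blocks ?Q w) (- typical_blocks ?Q w \<delta>)"
      using w by (intro measure_pmf.finite_measure_mono) (auto simp: typical_words_def)
    also have "\<dots> \<le> card (\<Union>b. set_pmf (?Q b)) / (\<delta>\<^sup>2 * length w)"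
      by (rule prob_not_typical_blocks) (use finite_images_iter assms \<open>w \<noteq> []\<close> in auto)
    finally show ?thesis
      by (simp add: measure_pmf.emeasure_eq_measure iter_length_eq[OF w] ennreal_leI del: measure_map_pmf emeasure_map_pmf)
  qed
  have "emeasure (subst_iter P (n + k) u) ?A =
      (\<integral>\<^sup>+w. emeasure (map_pmf concat (blocks ?Q w)) ?A \<partial>measure_pmf (subst_iter P n u))"
    unfolding subst_iter_add_blocks by (rule emeasure_bind_pmf)
  also have "\<dots> \<le> (\<integral>\<^sup>+w. ennreal ?c \<partial>measure_pmf (subst_iter P n u))"
    by (intro nn_integral_mono_AE AE_pmfI le)
  also have "\<dots> = ennreal ?c" by (simp add: measure_pmf.emeasure_space_1[simplified])
  finally show ?thesis
    by (simp add: measure_pmf.emeasure_eq_measure)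
qed

text \<open>
  The error has two parts, of at most \<open>\<epsilon>/2\<close> each after division by the length: the displacement of
  the blocks, small for large \<open>k\<close>, and the deviation of the block frequencies, which for fixed \<open>k\<close> is small
  once the accuracy \<open>1/(q+1)\<close> is small.
\<close>

lemma occ_sum_tendsto_along_typical_words:
  assumes f: "continuous_on UNIV f" "bounded (range f)" and u: "u \<noteq> []"
    and typical: "\<And>k q. \<forall>\<^sub>F n in sequentially. x (n + k) \<in> typical_words u n k (1 / Suc q)"
  shows "(\<lambda>n. occ_sum f a (x n) / iter_length P n u) \<longlonglongrightarrow> (\<integral>x. f x \<partial>limit_measure a)"
proof (rule LIMSEQ_by_shifted_approximation[OF predicted_sum_tendsto[OF u] pf_mean_occ_sum_tendsto[OF f]])
  fix \<epsilon> :: real assume "\<epsilon> > 0"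
  then have e2: "\<epsilon> / 2 > 0" by simp
  obtain G where G: "\<And>x. \<bar>f x\<bar> \<le> G" using f(2) by (auto simp: bounded_iff)
  have "G \<ge> 0" using order_trans[OF abs_ge_zero G] .
  obtain k0 where k0: "\<And>k n w vs. k \<ge> k0 \<Longrightarrow> w \<in> set_pmf (subst_iter P n u) \<Longrightarrow>
      vs \<in> set_pmf (blocks (\<lambda>b. subst_iter P k [b]) w) \<Longrightarrow>
      \<bar>occ_sum f a (concat vs) - (\<Sum>v\<leftarrow>vs. occ_sum f a v)\<bar> \<le> \<epsilon> / 2 * length (concat vs)"
    using occ_sum_block_approx[OF f(1) e2, of u a] by blast
  show "\<exists>k0. \<forall>k\<ge>k0. \<forall>\<^sub>F n in sequentially.
      \<bar>occ_sum f a (x (n + k)) / iter_length P (n + k) u - predicted_sum u f a k n / iter_length P (n + k) u\<bar> \<le> \<epsilon>"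
  proof (intro exI[of _ k0] allI impI)
    fix k assume k: "k0 \<le> k"
    let ?Q = "\<lambda>b. subst_iter P k [b]"
    let ?V = "\<Union>b. set_pmf (?Q b)"
    have finV: "finite ?V" using finite_images_iter by simp
    define N where "N = Max (length ` ?V)"
    define D where "D = real (card ?V) * (G * N)"
    have "D \<ge> 0" using \<open>G \<ge> 0\<close> by (simp add: D_def)
    have bd: "\<bar>occ_sum f a v\<bar> \<le> G * N" if "v \<in> set_pmf (?Q b)" for v b
    proof -
      have "length v \<le> N" unfolding N_def using that finV by (intro Max_ge) auto
      then have "G * length v \<le> G * N" using \<open>G \<ge> 0\<close> by (intro mult_left_mono) auto
      then show ?thesis using abs_occ_sum_le[of f G a v, OF G] by linarith
    qed
    obtain q where q: "D / (\<epsilon> / 2) < real q" using reals_Archimedean2 by blast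
    then have q: "1 / Suc q * D \<le> \<epsilon> / 2" using \<open>\<epsilon> > 0\<close> by (simp add: field_simps)
    show "\<forall>\<^sub>F n in sequentially.
      \<bar>occ_sum f a (x (n + k)) / iter_length P (n + k) u - predicted_sum u f a k n / iter_length P (n + k) u\<bar> \<le> \<epsilon>"
      using typical[of k q]
    proof eventually_elim
      case (elim n)
      then obtain w vs where w: "w \<in> set_pmf (subst_iter P n u)" and vs: "vs \<in> typical_blocks ?Q w (1 / Suc q)"
        and x: "x (n + k) = concat vs" by (auto simp: typical_words_def)
      have vs': "vs \<in> set_pmf (blocks ?Q w)" using vs by (simp add: typical_blocks_def)
      have xs: "x (n + k) \<in> set_pmf (subst_iter P (n + k) u)"
        unfolding subst_iter_add_blocks x using w vs' by auto
      have len: "real (length (concat vs)) = iter_length P (n + k) u" using iter_length_eq[OF xs] x by simp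
      have pos: "real (iter_length P (n + k) u) > 0" using iter_length_pos[OF u] by simp
      have "length w \<le> length (concat vs)"
      proof -
        have "list_all2 (\<lambda>b v. v \<in> set_pmf (?Q b)) w vs" using vs' by (simp add: set_blocks)
        then show ?thesis
        proof (induction rule: list_all2_induct)
          case (Cons b w v vs)
          have "v \<noteq> []" using subst_iter_Nil_iff[OF Nil_notin_images Cons(1)] by simp
          then have "length v \<ge> 1" by (cases v) auto
          then show ?case using Cons by simp
        qed simp
      qed
      have "\<bar>(\<Sum>v\<leftarrow>vs. occ_sum f a v) - predicted_sum u f a k n\<bar> \<le> 1 / Suc q * length w * D"
        unfolding sum_list_mean_occ_sum[OF w, symmetric] mean_occ_sum_def D_def
        by (rule typical_blocks_sum[OF _ vs]) (use finite_images_iter bd in auto)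
      also have "\<dots> = (1 / Suc q * D) * length w" by simp
      also have "\<dots> \<le> \<epsilon> / 2 * length (concat vs)"
        using q \<open>length w \<le> length (concat vs)\<close> \<open>\<epsilon> > 0\<close> by (intro mult_mono) auto
      finally have "\<bar>occ_sum f a (x (n + k)) - predicted_sum u f a k n\<bar> \<le> \<epsilon> * iter_length P (n + k) u"
        using k0[OF k w vs'] unfolding x len by linarith
      then show ?case using pos by (simp add: field_simps flip: diff_divide_distrib)
    qed
  qed
qed

section \<open>The limit of the expected measures\<close>

text \<open>
  Taking expectations, the sum over the blocks becomes exactly the predicted sum, so only the
  displacement of the blocks causes an error.
\<close>

lemma expected_occ_sum_tendsto:
  assumes f: "continuous_on UNIV f" "bounded (range f)" and u: "u \<noteq> []"
  shows "(\<lambda>n. measure_pmf.expectation (subst_iter P n u) (occ_sum f a) / iter_length P n u)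
    \<longlonglongrightarrow> (\<integral>x. f x \<partial>limit_measure a)"
proof (rule LIMSEQ_by_shifted_approximation[OF predicted_sum_tendsto[OF u] pf_mean_occ_sum_tendsto[OF f]])
  fix \<epsilon> :: real assume "\<epsilon> > 0"
  obtain k0 where k0: "\<And>k n w vs. k \<ge> k0 \<Longrightarrow> w \<in> set_pmf (subst_iter P n u) \<Longrightarrow>
      vs \<in> set_pmf (blocks (\<lambda>b. subst_iter P k [b]) w) \<Longrightarrow>
      \<bar>occ_sum f a (concat vs) - (\<Sum>v\<leftarrow>vs. occ_sum f a v)\<bar> \<le> \<epsilon> * length (concat vs)"
    using occ_sum_block_approx[OF f(1) \<open>\<epsilon> > 0\<close>, of u a] by blast
  have "\<bar>measure_pmf.expectation (subst_iter P (n + k) u) (occ_sum f a) / iter_length P (n + k) u -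
      predicted_sum u f a k n / iter_length P (n + k) u\<bar> \<le> \<epsilon>" if k: "k \<ge> k0" for k n
  proof -
    let ?Q = "\<lambda>b. subst_iter P k [b]" and ?p = "subst_iter P n u"
    let ?N = "real (iter_length P (n + k) u)"
    have pos: "?N > 0" using iter_length_pos[OF u] by simp
    have finB: "finite (set_pmf (blocks ?Q w))" for w by (rule finite_set_blocks[OF finite_images_iter])
    have one: "\<bar>measure_pmf.expectation (blocks ?Q w) (\<lambda>vs. occ_sum f a (concat vs)) - predicted_sum u f a k n\<bar> \<le> \<epsilon> * ?N"
      if w: "w \<in> set_pmf ?p" for w
    proof -
      have "predicted_sum u f a k n = measure_pmf.expectation (blocks ?Q w) (\<lambda>vs. \<Sum>v\<leftarrow>vs. occ_sum f a v)"
        using expectation_blocks_sum[where Q = ?Q and u = w and g = "occ_sum f a", OF finite_images_iter]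
        by (simp add: mean_occ_sum_def flip: sum_list_mean_occ_sum[OF w])
      then have "measure_pmf.expectation (blocks ?Q w) (\<lambda>vs. occ_sum f a (concat vs)) - predicted_sum u f a k n =
          measure_pmf.expectation (blocks ?Q w) (\<lambda>vs. occ_sum f a (concat vs) - (\<Sum>v\<leftarrow>vs. occ_sum f a v))"
        by (subst Bochner_Integration.integral_diff) (auto simp: integrable_measure_pmf_finite finB)
      also have "\<bar>\<dots>\<bar> \<le> measure_pmf.expectation (blocks ?Q w) (\<lambda>vs. \<bar>occ_sum f a (concat vs) - (\<Sum>v\<leftarrow>vs. occ_sum f a v)\<bar>)"
        by (rule integral_abs_bound)
      also have "\<dots> \<le> measure_pmf.expectation (blocks ?Q w) (\<lambda>_. \<epsilon> * ?N)"
      proof (rule integral_mono_AE)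
        show "AE vs in blocks ?Q w. \<bar>occ_sum f a (concat vs) - (\<Sum>v\<leftarrow>vs. occ_sum f a v)\<bar> \<le> \<epsilon> * ?N"
        proof (rule AE_pmfI)
          fix vs assume vs: "vs \<in> set_pmf (blocks ?Q w)"
          have "concat vs \<in> set_pmf (subst_iter P (n + k) u)"
            unfolding subst_iter_add_blocks using w vs by auto
          then show "\<bar>occ_sum f a (concat vs) - (\<Sum>v\<leftarrow>vs. occ_sum f a v)\<bar> \<le> \<epsilon> * ?N"
            using k0[OF k w vs] by (simp add: iter_length_eq)
        qed
      qed (simp_all add: integrable_measure_pmf_finite finB)
      finally show ?thesis by simp
    qed
    have "measure_pmf.expectation (subst_iter P (n + k) u) (occ_sum f a) =
        measure_pmf.expectation ?p (\<lambda>w. measure_pmf.expectation (blocks ?Q w) (\<lambda>vs. occ_sum f a (concat vs)))"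
      unfolding subst_iter_add_blocks by (simp add: expectation_bind_finite finite_images_iter finB)
    then have "measure_pmf.expectation (subst_iter P (n + k) u) (occ_sum f a) - predicted_sum u f a k n =
        measure_pmf.expectation ?p (\<lambda>w. measure_pmf.expectation (blocks ?Q w) (\<lambda>vs. occ_sum f a (concat vs)) - predicted_sum u f a k n)"
      by (simp add: integrable_measure_pmf_finite finite_images_iter)
    also have "\<bar>\<dots>\<bar> \<le> measure_pmf.expectation ?p (\<lambda>w. \<bar>measure_pmf.expectation (blocks ?Q w) (\<lambda>vs. occ_sum f a (concat vs)) - predicted_sum u f a k n\<bar>)"
      by (rule integral_abs_bound)
    also have "\<dots> \<le> measure_pmf.expectation ?p (\<lambda>_. \<epsilon> * ?N)"
      by (intro integral_mono_AE AE_pmfI one) (simp_all add: integrable_measure_pmf_finite finite_images_iter)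
    finally have "\<bar>measure_pmf.expectation (subst_iter P (n + k) u) (occ_sum f a) - predicted_sum u f a k n\<bar> \<le> \<epsilon> * ?N"
      by simp
    then show ?thesis using pos by (simp add: field_simps flip: diff_divide_distrib)
  qed
  then show "\<exists>k0. \<forall>k\<ge>k0. \<forall>\<^sub>F n in sequentially.
      \<bar>measure_pmf.expectation (subst_iter P (n + k) u) (occ_sum f a) / iter_length P (n + k) u -
        predicted_sum u f a k n / iter_length P (n + k) u\<bar> \<le> \<epsilon>"
    by (intro exI[of _ k0] allI impI always_eventually)
qed

lemma weakly_converges_expected:
  assumes "u \<noteq> []"
  shows "weakly_converges (\<lambda>n. scale_measure (ennreal (1 / real (iter_length P n u)))
    (expected_occurrence_measure P L R a n u)) (limit_measure a)"
  unfolding weakly_converges_def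
proof (intro allI impI)
  fix f :: "real ^ 'd \<Rightarrow> real" assume f: "continuous_on UNIV f \<and> bounded (range f)"
  then have m: "f \<in> borel_measurable borel" by (simp add: measurable_of_continuous)
  then have m': "f \<in> borel_measurable (expected_occurrence_measure P L R a n u)" for n
    by (simp add: measurable_cong_sets[OF sets_expected_occurrence_measure refl])
  show "(\<lambda>n. \<integral>x. f x \<partial>scale_measure (ennreal (1 / real (iter_length P n u)))
      (expected_occurrence_measure P L R a n u)) \<longlonglongrightarrow> (\<integral>x. f x \<partial>limit_measure a)"
    using expected_occ_sum_tendsto[of f u a] f assms
    by (simp add: integral_scale_measure m' integral_expected_occurrence_measure[OF m])
qed

text \<open>
  Any finite Borel measure with the defining property has the same integrals of bounded continuous
  functions, already because of the convergence for a single starting word.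
\<close>

lemma rauzy_measure_eq_limit_measure: "rauzy_measure P L R a = limit_measure a"
  unfolding rauzy_measure_def
proof (rule the_equality)
  show "finite_measure (limit_measure a) \<and> sets (limit_measure a) = sets borel \<and>
      (\<forall>u. u \<noteq> [] \<longrightarrow> weakly_converges (\<lambda>n. scale_measure (ennreal (1 / real (iter_length P n u)))
        (expected_occurrence_measure P L R a n u)) (limit_measure a))"
    using finite_limit_measure sets_limit_measure weakly_converges_expected by blast
next
  fix \<nu> :: "(real ^ 'd) measure"
  assume \<nu>: "finite_measure \<nu> \<and> sets \<nu> = sets borel \<and>
      (\<forall>u. u \<noteq> [] \<longrightarrow> weakly_converges (\<lambda>n. scale_measure (ennreal (1 / real (iter_length P n u)))
        (expected_occurrence_measure P L R a n u)) \<nu>)"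
  show "\<nu> = limit_measure a"
  proof (rule finite_measure_eqI_continuous)
    fix f :: "real ^ 'd \<Rightarrow> real" assume "continuous_on UNIV f" "bounded (range f)"
    then show "(\<integral>x. f x \<partial>\<nu>) = (\<integral>x. f x \<partial>limit_measure a)"
      using \<nu>[THEN conjunct2, THEN conjunct2, rule_format, of "[a]"] weakly_converges_expected[of "[a]" a]
      unfolding weakly_converges_def by (blast intro: LIMSEQ_unique)
  qed (use \<nu> finite_limit_measure sets_limit_measure in auto)
qed

end

section \<open>Almost sure convergence\<close>

text \<open>
  The Markov property conditions on the whole past. There are countably many histories, so
  summing over those that end in \<open>w'\<close> gives the one-step transition probabilities.
\<close>

lemma subst_chain_law:
  fixes P :: "'d::finite \<Rightarrow> 'd list pmf"
  assumes chain: "subst_chain P v \<Omega> X"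
  shows "distr \<Omega> (count_space UNIV) (X n) = measure_pmf (subst_iter P n v)"
proof -
  interpret prob_space \<Omega> using chain by (simp add: subst_chain_def)
  have X[measurable]: "X n \<in> measurable \<Omega> (count_space UNIV)" for n
    using chain by (simp add: subst_chain_def)
  have X0: "AE \<omega> in \<Omega>. X 0 \<omega> = v" using chain by (simp add: subst_chain_def)
  have markov: "emeasure \<Omega> {\<omega> \<in> space \<Omega>. (\<forall>k\<le>n. X k \<omega> = ws k) \<and> X (Suc n) \<omega> = w} =
      emeasure \<Omega> {\<omega> \<in> space \<Omega>. \<forall>k\<le>n. X k \<omega> = ws k} * pmf (subst_word P (ws n)) w" for n ws w
    using chain by (simp add: subst_chain_def emeasure_eq_measure ennreal_mult'')
  have joint: "emeasure \<Omega> {\<omega> \<in> space \<Omega>. X n \<omega> = w' \<and> X (Suc n) \<omega> = w} =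
      emeasure \<Omega> {\<omega> \<in> space \<Omega>. X n \<omega> = w'} * pmf (subst_word P w') w" for n w' w
  proof -
    \<comment> \<open>a history up to time \<open>n\<close> as a list of \<open>n + 1\<close> words\<close>
    define H where "H = {hs :: 'd list list. length hs = Suc n \<and> hs ! n = w'}"
    have hist: "(\<exists>hs\<in>H. \<forall>k\<le>n. X k \<omega> = hs ! k) \<longleftrightarrow> X n \<omega> = w'" for \<omega>
    proof
      assume "X n \<omega> = w'"
      then show "\<exists>hs\<in>H. \<forall>k\<le>n. X k \<omega> = hs ! k"
        by (intro bexI[of _ "map (\<lambda>k. X k \<omega>) [0..<Suc n]"]) (auto simp: H_def less_Suc_eq_le simp del: upt_Suc)
    qed (auto simp: H_def)
    have cH: "countable H" by (rule countableI_type)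
    have uniq: "hs = hs'" if "hs \<in> H" "hs' \<in> H" "\<forall>k\<le>n. X k \<omega> = hs ! k" "\<forall>k\<le>n. X k \<omega> = hs' ! k" for hs hs' \<omega>
      using that by (intro nth_equalityI) (auto simp: H_def less_Suc_eq_le)
    have "emeasure \<Omega> {\<omega> \<in> space \<Omega>. X n \<omega> = w' \<and> X (Suc n) \<omega> = w} =
        emeasure \<Omega> (\<Union>hs\<in>H. {\<omega> \<in> space \<Omega>. (\<forall>k\<le>n. X k \<omega> = hs ! k) \<and> X (Suc n) \<omega> = w})"
      by (intro arg_cong[of _ _ "emeasure \<Omega>"]) (auto simp flip: hist)
    also have "\<dots> = (\<integral>\<^sup>+hs. emeasure \<Omega> {\<omega> \<in> space \<Omega>. (\<forall>k\<le>n. X k \<omega> = hs ! k) \<and> X (Suc n) \<omega> = w} \<partial>count_space H)"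
      using uniq cH by (intro emeasure_UN_countable) (auto simp: disjoint_family_on_def)
    also have "\<dots> = (\<integral>\<^sup>+hs. emeasure \<Omega> {\<omega> \<in> space \<Omega>. \<forall>k\<le>n. X k \<omega> = hs ! k} * pmf (subst_word P w') w \<partial>count_space H)"
      by (intro nn_integral_cong) (auto simp: markov H_def)
    also have "\<dots> = (\<integral>\<^sup>+hs. emeasure \<Omega> {\<omega> \<in> space \<Omega>. \<forall>k\<le>n. X k \<omega> = hs ! k} \<partial>count_space H) * pmf (subst_word P w') w"
      by (rule nn_integral_multc) simp
    also have "(\<integral>\<^sup>+hs. emeasure \<Omega> {\<omega> \<in> space \<Omega>. \<forall>k\<le>n. X k \<omega> = hs ! k} \<partial>count_space H) =
        emeasure \<Omega> (\<Union>hs\<in>H. {\<omega> \<in> space \<Omega>. \<forall>k\<le>n. X k \<omega> = hs ! k})"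
      using uniq cH by (intro emeasure_UN_countable[symmetric]) (auto simp: disjoint_family_on_def)
    also have "(\<Union>hs\<in>H. {\<omega> \<in> space \<Omega>. \<forall>k\<le>n. X k \<omega> = hs ! k}) = {\<omega> \<in> space \<Omega>. X n \<omega> = w'}"
      by (auto simp flip: hist)
    finally show ?thesis .
  qed
  have law: "emeasure \<Omega> {\<omega> \<in> space \<Omega>. X n \<omega> = w} = ennreal (pmf (subst_iter P n v) w)" for w
  proof (induction n arbitrary: w)
    case 0
    have "emeasure \<Omega> {\<omega> \<in> space \<Omega>. X 0 \<omega> = w} = emeasure \<Omega> (if v = w then space \<Omega> else {})"
      by (rule emeasure_eq_AE) (use X0 in \<open>auto split: if_splits\<close>)
    then show ?case by (simp add: emeasure_space_1 pmf_return)
  next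
    case (Suc n)
    have "emeasure \<Omega> {\<omega> \<in> space \<Omega>. X (Suc n) \<omega> = w} =
        emeasure \<Omega> (\<Union>w'. {\<omega> \<in> space \<Omega>. X n \<omega> = w' \<and> X (Suc n) \<omega> = w})"
      by (intro arg_cong[of _ _ "emeasure \<Omega>"]) auto
    also have "\<dots> = (\<integral>\<^sup>+w'. emeasure \<Omega> {\<omega> \<in> space \<Omega>. X n \<omega> = w' \<and> X (Suc n) \<omega> = w} \<partial>count_space UNIV)"
      by (intro emeasure_UN_countable) (auto simp: disjoint_family_on_def)
    also have "\<dots> = (\<integral>\<^sup>+w'. pmf (subst_iter P n v) w' * ennreal (pmf (subst_word P w') w) \<partial>count_space UNIV)"
      by (simp add: joint Suc.IH)
    also have "\<dots> = ennreal (pmf (subst_iter P (Suc n) v) w)"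
      by (simp add: ennreal_pmf_bind nn_integral_measure_pmf)
    finally show ?case .
  qed
  show ?thesis
  proof (rule measure_eqI_countable[of _ UNIV])
    fix w :: "'d list"
    have "emeasure (distr \<Omega> (count_space UNIV) (X n)) {w} = emeasure \<Omega> {\<omega> \<in> space \<Omega>. X n \<omega> = w}"
      by (subst emeasure_distr) (auto intro!: arg_cong[of _ _ "emeasure \<Omega>"])
    then show "emeasure (distr \<Omega> (count_space UNIV) (X n)) {w} = emeasure (subst_iter P n v) {w}"
      by (simp add: law emeasure_pmf_single)
  qed auto
qed

context pisot_substitution
begin

lemma summable_inverse_iter_length:
  assumes "u \<noteq> []"
  shows "summable (\<lambda>n. 1 / real (iter_length P n u))"
proof (rule summable_comparison_test_ev)
  let ?l = "L \<bullet> abelianisation u"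
  have l: "?l > 0" using L_abelianisation_pos[OF assms] .
  have "\<forall>\<^sub>F n in sequentially. ?l / 2 < iter_length P n u / lam ^ n"
    using iter_length_tendsto l by (intro order_tendstoD) auto
  then show "\<forall>\<^sub>F n in sequentially. norm (1 / real (iter_length P n u)) \<le> 2 / ?l * (1 / lam) ^ n"
  proof eventually_elim
    case (elim n)
    then show ?case using l lam_gt_1 iter_length_pos[OF assms, of n] by (simp add: field_simps)
  qed
  show "summable (\<lambda>n. 2 / ?l * (1 / lam) ^ n)"
    using lam_gt_1 by (intro summable_mult summable_geometric) auto
qed

text \<open>
  The Borel--Cantelli lemma applies because the lengths grow exponentially.
\<close>

lemma AE_eventually_typical:
  assumes chain: "subst_chain P v \<Omega> X" and v: "v \<noteq> []" and "\<delta> > 0"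
  shows "AE \<omega> in \<Omega>. \<forall>\<^sub>F n in sequentially. X (n + k) \<omega> \<in> typical_words v n k \<delta>"
proof -
  interpret prob_space \<Omega> using chain by (simp add: subst_chain_def)
  have X[measurable]: "X n \<in> measurable \<Omega> (count_space UNIV)" for n
    using chain by (simp add: subst_chain_def)
  define A where "A = (\<lambda>n. {\<omega> \<in> space \<Omega>. X (n + k) \<omega> \<notin> typical_words v n k \<delta>})"
  let ?c = "card (\<Union>b. set_pmf (subst_iter P k [b])) / \<delta>\<^sup>2"
  have A[measurable]: "A n \<in> sets \<Omega>" for n unfolding A_def by measurable
  have prob: "measure \<Omega> (A n) \<le> ?c * (1 / real (iter_length P n v))" for n
  proof -
    have "measure \<Omega> (A n) = measure (distr \<Omega> (count_space UNIV) (X (n + k))) (- typical_words v n k \<delta>)"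
      unfolding A_def by (subst measure_distr) (auto intro!: arg_cong[of _ _ "measure \<Omega>"])
    also have "\<dots> = measure_pmf.prob (subst_iter P (n + k) v) (- typical_words v n k \<delta>)"
      by (simp only: subst_chain_law[OF chain])
    also have "\<dots> \<le> card (\<Union>b. set_pmf (subst_iter P k [b])) / (\<delta>\<^sup>2 * iter_length P n v)"
      by (rule prob_not_typical_words[OF v \<open>\<delta> > 0\<close>])
    finally show ?thesis by simp
  qed
  have "AE \<omega> in \<Omega>. \<forall>\<^sub>F n in sequentially. \<omega> \<in> space \<Omega> - A n"
  proof (rule borel_cantelli_AE1)
    show "summable (\<lambda>n. measure \<Omega> (A n))"
      by (rule summable_comparison_test'[OF summable_mult[OF summable_inverse_iter_length[OF v], of ?c], of 0])
        (simp only: real_norm_def abs_of_nonneg[OF measure_nonneg] prob)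
  qed (simp_all add: emeasure_eq_measure)
  then show ?thesis
    by eventually_elim (auto simp: A_def elim: eventually_mono)
qed

lemma weakly_converges_along_typical_words:
  assumes "u \<noteq> []"
    and "\<And>k q. \<forall>\<^sub>F n in sequentially. x (n + k) \<in> typical_words u n k (1 / Suc q)"
  shows "weakly_converges (\<lambda>n. scale_measure (ennreal (1 / real (iter_length P n u)))
    (occurrence_measure L R a (x n))) (rauzy_measure P L R a)"
  unfolding weakly_converges_def
proof (intro allI impI)
  fix f :: "real ^ 'd \<Rightarrow> real" assume f: "continuous_on UNIV f \<and> bounded (range f)"
  then have m: "f \<in> borel_measurable borel" by (simp add: measurable_of_continuous)
  then have m': "f \<in> borel_measurable (occurrence_measure L R a w)" for w
    by (simp add: measurable_cong_sets[OF sets_occurrence_measure refl])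
  show "(\<lambda>n. \<integral>x. f x \<partial>scale_measure (ennreal (1 / real (iter_length P n u)))
      (occurrence_measure L R a (x n))) \<longlonglongrightarrow> (\<integral>x. f x \<partial>rauzy_measure P L R a)"
    using occ_sum_tendsto_along_typical_words[of f u x a] f assms
    by (simp add: integral_scale_measure m' integral_occurrence_measure[OF m] rauzy_measure_eq_limit_measure)
qed

end

theorem proposition5p10:
  fixes P :: "'d::finite \<Rightarrow> 'd list pmf"
    and L R :: "real ^ 'd"
    and v :: "'d list"
    and \<Omega> :: "'w measure"
    and X :: "nat \<Rightarrow> 'w \<Rightarrow> 'd list"
  assumes "random_substitution P"
    and "compatible P"
    and "irreducible_pisot P"
    and "pf_eigenvectors P L R"
    and "v \<noteq> []"
    and "subst_chain P v \<Omega> X"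
  shows "\<forall>a. AE \<omega> in \<Omega>.
    weakly_converges
      (\<lambda>n. scale_measure (ennreal (1 / real (iter_length P n v)))
             (occurrence_measure L R a (X n \<omega>)))
      (rauzy_measure P L R a)"
proof
  fix a
  interpret pisot_substitution P L R
    using assms by unfold_locales
  have "AE \<omega> in \<Omega>. \<forall>k q. \<forall>\<^sub>F n in sequentially. X (n + k) \<omega> \<in> typical_words v n k (1 / Suc q)"
    unfolding AE_all_countable using AE_eventually_typical[OF assms(6,5)] by simp
  then show "AE \<omega> in \<Omega>. weakly_converges
      (\<lambda>n. scale_measure (ennreal (1 / real (iter_length P n v)))
             (occurrence_measure L R a (X n \<omega>)))
      (rauzy_measure P L R a)"
  proof eventually_elim
    case (elim \<omega>)
    then show ?case
      by (intro weakly_converges_along_typical_words[OF assms(5)]) simp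
  qed
qed

end
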